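(* Let $U$ be a multiplication-invariant potential on $\Omega=\{-1,1\}^{\mathbb N}$ with finite set of primes $P(J)=\{p_1<\cdots<p_d\}$ and associated shift-invariant potential $V$ on $\Omega_{0,d}=\{-1,1\}^{(\mathbb N_0)^d}$. Assume that $U$ is layer unique, with $\mu^V_\infty$ the unique Gibbs measure for $V$ on $\Omega_{0,d}$. Then there exists a unique Gibbs measure $\mu^U_\infty$ associated to $U$ on $\Omega$. Under $\mu^U_\infty$, the $\tau$ spins defined by $$\tau^r_{x_1,\ldots,x_d}=\sigma_{r\prod_{k=1}^dp_k^{x_k}},\qquad r\in\mathcal K(p_1,\ldots,p_d),\ x_k\in\mathbb N_0,$$ form independent copies (with respect to $r$) of the measure $\mu^V_\infty$, i.e. the configurations $\tau^r\in\Omega_{0,d}$, $r\in\mathcal K(p_1,\ldots,p_d)$, are independent and each has distribution $\mu_\infty^V$.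
   Context: $\mathbb N=\{1,2,\ldots\}$, $\mathbb N_0=\mathbb N\cup\{0\}$. Multiplicative shift: $(T_i\sigma)_j=\sigma_{ij}$ for $\sigma\in\Omega$, $i,j\in\mathbb N$. A potential is a function $U(A,\sigma)$ of finite subsets $A\subset\mathbb N$ and $\sigma\in\Omega$ such that $U(A,\sigma)$ depends only on $\sigma_A$ and $\sum_{A\ni i}\max_{\sigma_A}|U(A,\sigma)|<\infty$ for all $i\in\mathbb N$. It is multiplication invariant if $U(iA,\sigma)=U(A,T_i\sigma)$ for all finite $A\subset\mathbb N$, $\sigma\in\Omega$, $i\in\mathbb N$. All multiplication-invariant potentials considered are of the following form: there is a collection $\mathcal A$ of finite subsets of $\mathbb N$ and reals $J_A$, $A\in\mathcal A$, such that $U(iA,\sigma)=J_A\prod_{j\in A}(T_i\sigma)_j$ for $i\in\mathbb N$, $A\in\mathcal A$, and $U(B,\sigma)=0$ if $B$ is not of the form $iA$ with $A\in\mathcal A$, $i\in\mathbb N$ (the sets $iA$ being pairwise distinct, so that this is well defined). $P(J)$ is the set of primes appearing in the prime factorizations of the elements of $\bigcup_{A\in\mathcal A}A$; it is assumed finite, and $d=|P(J)|\ge1$ is the dimension. $\mathcal K(p_1,\ldots,p_d)$ is the set of $r\in\mathbb N$ not divisible by any of $p_1,\ldots,p_d$; every $i\in\mathbb N$ is uniquely $i=r\prod_kp_k^{x_k}$ with $r\in\mathcal K(p_1,\ldots,p_d)$ and $x_k\in\mathbb N_0$. The associated shift-invariant potential $V$ on $\Omega_{0,d}$: for $A\in\mathcal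 A$ let $A'=\{x\in(\mathbb N_0)^d:\prod_kp_k^{x_k}\in A\}$; then $V(A'+y,\tau)=J_A\prod_{x\in A'}\tau_{x+y}$ for $y\in(\mathbb N_0)^d$, and $V(B,\tau)=0$ for other finite $B\subset(\mathbb N_0)^d$. $U$ is layer unique if there is exactly one Gibbs measure for $V$ on $\Omega_{0,d}$. A Gibbs measure for a potential $W$ is a probability measure such that for every finite set $\Lambda$ of sites the conditional distribution of the spins in $\Lambda$ given the configuration $\eta$ outside $\Lambda$ is proportional to $\exp\big(-\sum_{A\cap\Lambda\neq\emptyset}W(A,\sigma_\Lambda\eta_{\Lambda^c})\big)$. *)

theory Defs
  imports "HOL-Probability.Probability" "HOL-Computational_Algebra.Primes"
begin

text \<open>
  Spin systems on a countable set of sites \<open>S\<close>. Configurations are extensional functions on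
  \<open>S\<close>. The set \<open>S\<close> is \<open>{1..}\<close> for the multiplicative model and the lattice of vectors with
  nonnegative integer coordinates for the associated shift-invariant model.
\<close>

definition spins :: "real set" where
  "spins = {-1, 1}"

definition configs :: "'s set \<Rightarrow> ('s \<Rightarrow> real) set" where
  "configs S = (S \<rightarrow>\<^sub>E spins)"

definition config_space :: "'s set \<Rightarrow> ('s \<Rightarrow> real) measure" where
  "config_space S = (\<Pi>\<^sub>M i\<in>S. count_space spins)"

definition potential :: "'s set \<Rightarrow> ('s set \<Rightarrow> ('s \<Rightarrow> real) \<Rightarrow> real) \<Rightarrow> bool" where
  "potential S W \<longleftrightarrow>
     (\<forall>A \<sigma> \<sigma>'. finite A \<longrightarrow> A \<subseteq> S \<longrightarrow> \<sigma> \<in> configs S \<longrightarrow> \<sigma>' \<in> configs S \<longrightarrow>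
        (\<forall>i\<in>A. \<sigma> i = \<sigma>' i) \<longrightarrow> W A \<sigma> = W A \<sigma>') \<and>
     (\<forall>i\<in>S. (\<lambda>A. Max ((\<lambda>\<sigma>. \<bar>W A \<sigma>\<bar>) ` configs S)) summable_on
        {A. finite A \<and> A \<subseteq> S \<and> i \<in> A})"

definition hamiltonian ::
    "'s set \<Rightarrow> ('s set \<Rightarrow> ('s \<Rightarrow> real) \<Rightarrow> real) \<Rightarrow> 's set \<Rightarrow> ('s \<Rightarrow> real) \<Rightarrow> real" where
  "hamiltonian S W \<Lambda> \<sigma> = (\<Sum>\<^sub>\<infinity>A\<in>{A. finite A \<and> A \<subseteq> S \<and> A \<inter> \<Lambda> \<noteq> {}}. W A \<sigma>)"

text \<open>
  The configuration \<open>merge \<Lambda> (S - \<Lambda>) (\<xi>, \<eta>)\<close> is \<open>\<xi>\<close> inside \<open>\<Lambda>\<close> and \<open>\<eta>\<close> outside.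
\<close>

definition gibbs_kernel ::
    "'s set \<Rightarrow> ('s set \<Rightarrow> ('s \<Rightarrow> real) \<Rightarrow> real) \<Rightarrow> 's set \<Rightarrow> ('s \<Rightarrow> real) \<Rightarrow> ('s \<Rightarrow> real) \<Rightarrow> real"
  where
  "gibbs_kernel S W \<Lambda> \<xi> \<eta> =
     exp (- hamiltonian S W \<Lambda> (merge \<Lambda> (S - \<Lambda>) (\<xi>, \<eta>))) /
     (\<Sum>\<zeta>\<in>configs \<Lambda>. exp (- hamiltonian S W \<Lambda> (merge \<Lambda> (S - \<Lambda>) (\<zeta>, \<eta>))))"

definition outside_algebra :: "'s set \<Rightarrow> 's set \<Rightarrow> ('s \<Rightarrow> real) measure" where
  "outside_algebra S \<Lambda> =
     vimage_algebra (configs S) (\<lambda>\<sigma>. restrict \<sigma> (S - \<Lambda>)) (config_space (S - \<Lambda>))"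

text \<open>
  Since \<open>configs \<Lambda>\<close> is finite, the conditional distribution of the spins in \<open>\<Lambda>\<close> is given by the
  conditional probabilities of the cylinder events fixing the configuration in \<open>\<Lambda>\<close>.
\<close>

definition gibbs_measure ::
    "'s set \<Rightarrow> ('s set \<Rightarrow> ('s \<Rightarrow> real) \<Rightarrow> real) \<Rightarrow> ('s \<Rightarrow> real) measure \<Rightarrow> bool" where
  "gibbs_measure S W \<mu> \<longleftrightarrow>
     prob_space \<mu> \<and> sets \<mu> = sets (config_space S) \<and>
     (\<forall>\<Lambda>. finite \<Lambda> \<longrightarrow> \<Lambda> \<subseteq> S \<longrightarrow> (\<forall>\<xi>\<in>configs \<Lambda>.
        AE \<eta> in \<mu>. real_cond_exp \<mu> (outside_algebra S \<Lambda>)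
            (indicator {\<sigma> \<in> configs S. restrict \<sigma> \<Lambda> = \<xi>}) \<eta>
          = gibbs_kernel S W \<Lambda> \<xi> \<eta>))"

definition mult_shift :: "nat \<Rightarrow> (nat \<Rightarrow> real) \<Rightarrow> nat \<Rightarrow> real" where
  "mult_shift i \<sigma> = (\<lambda>j\<in>{1..}. \<sigma> (i * j))"

definition mult_invariant :: "(nat set \<Rightarrow> (nat \<Rightarrow> real) \<Rightarrow> real) \<Rightarrow> bool" where
  "mult_invariant U \<longleftrightarrow>
     (\<forall>A \<sigma>. \<forall>i\<ge>1. finite A \<longrightarrow> A \<subseteq> {1..} \<longrightarrow> \<sigma> \<in> configs {1..} \<longrightarrow>
        U ((*) i ` A) \<sigma> = U A (mult_shift i \<sigma>))"

text \<open>
  The injectivity clause says that the sets \<open>iA\<close> are pairwise distinct, as \<open>i\<close> and \<open>A\<close> both vary.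
\<close>

definition interaction_form ::
    "nat set set \<Rightarrow> (nat set \<Rightarrow> real) \<Rightarrow> (nat set \<Rightarrow> (nat \<Rightarrow> real) \<Rightarrow> real) \<Rightarrow> bool" where
  "interaction_form \<A> J U \<longleftrightarrow>
     (\<forall>A\<in>\<A>. finite A \<and> A \<subseteq> {1..}) \<and>
     inj_on (\<lambda>(i, A). (*) i ` A) ({1..} \<times> \<A>) \<and>
     (\<forall>i\<ge>1. \<forall>A\<in>\<A>. \<forall>\<sigma>\<in>configs {1..}.
        U ((*) i ` A) \<sigma> = J A * (\<Prod>j\<in>A. mult_shift i \<sigma> j)) \<and>
     (\<forall>B. finite B \<longrightarrow> B \<subseteq> {1..} \<longrightarrow> \<not> (\<exists>i\<ge>1. \<exists>A\<in>\<A>. B = (*) i ` A) \<longrightarrow>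
        (\<forall>\<sigma>\<in>configs {1..}. U B \<sigma> = 0))"

definition primes_of :: "nat set set \<Rightarrow> nat set" where
  "primes_of \<A> = (\<Union>a\<in>\<Union>\<A>. prime_factors a)"

definition lattice :: "nat \<Rightarrow> (nat \<Rightarrow> nat) set" where
  "lattice d = ({1..d} \<rightarrow>\<^sub>E UNIV)"

definition lattice_add :: "nat \<Rightarrow> (nat \<Rightarrow> nat) \<Rightarrow> (nat \<Rightarrow> nat) \<Rightarrow> (nat \<Rightarrow> nat)" where
  "lattice_add d x y = (\<lambda>k\<in>{1..d}. x k + y k)"

definition monomial :: "nat \<Rightarrow> (nat \<Rightarrow> nat) \<Rightarrow> (nat \<Rightarrow> nat) \<Rightarrow> nat" where
  "monomial d p x = (\<Prod>k=1..d. p k ^ x k)"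

definition layers :: "nat \<Rightarrow> (nat \<Rightarrow> nat) \<Rightarrow> nat set" where
  "layers d p = {r. r \<ge> 1 \<and> (\<forall>k\<in>{1..d}. \<not> p k dvd r)}"

definition exponents :: "nat \<Rightarrow> (nat \<Rightarrow> nat) \<Rightarrow> nat set \<Rightarrow> (nat \<Rightarrow> nat) set" where
  "exponents d p A = {x \<in> lattice d. monomial d p x \<in> A}"

text \<open>
  These equations determine \<open>V\<close> on finite subsets of the lattice and on configurations, which is
  all that \<open>gibbs_measure\<close> uses. If the sets \<open>iA\<close> are pairwise distinct and the \<open>p k\<close> are
  the distinct elements of \<open>primes_of \<A>\<close>, then the translates of the sets \<open>exponents d p A\<close> are
  pairwise distinct as well, so such a \<open>V\<close> exists.
\<close>

definition associated_potential ::
    "nat \<Rightarrow> (nat \<Rightarrow> nat) \<Rightarrow> nat set set \<Rightarrow> (nat set \<Rightarrow> real) \<Rightarrow>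
     ((nat \<Rightarrow> nat) set \<Rightarrow> ((nat \<Rightarrow> nat) \<Rightarrow> real) \<Rightarrow> real) \<Rightarrow> bool" where
  "associated_potential d p \<A> J V \<longleftrightarrow>
     (\<forall>A\<in>\<A>. \<forall>y\<in>lattice d. \<forall>\<tau>\<in>configs (lattice d).
        V ((\<lambda>x. lattice_add d x y) ` exponents d p A) \<tau>
          = J A * (\<Prod>x\<in>exponents d p A. \<tau> (lattice_add d x y))) \<and>
     (\<forall>B. finite B \<longrightarrow> B \<subseteq> lattice d \<longrightarrow>
        \<not> (\<exists>A\<in>\<A>. \<exists>y\<in>lattice d. B = (\<lambda>x. lattice_add d x y) ` exponents d p A) \<longrightarrow>
        (\<forall>\<tau>\<in>configs (lattice d). V B \<tau> = 0))"

text \<open>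
  Layer uniqueness of the multiplicative potential, in terms of its associated potential \<open>V\<close>.
\<close>

definition layer_unique ::
    "nat \<Rightarrow> ((nat \<Rightarrow> nat) set \<Rightarrow> ((nat \<Rightarrow> nat) \<Rightarrow> real) \<Rightarrow> real) \<Rightarrow> bool" where
  "layer_unique d V \<longleftrightarrow> (\<exists>!\<nu>. gibbs_measure (lattice d) V \<nu>)"

definition layer_spins ::
    "nat \<Rightarrow> (nat \<Rightarrow> nat) \<Rightarrow> nat \<Rightarrow> (nat \<Rightarrow> real) \<Rightarrow> (nat \<Rightarrow> nat) \<Rightarrow> real" where
  "layer_spins d p r \<sigma> = (\<lambda>x\<in>lattice d. \<sigma> (r * monomial d p x))"

end

theory Submission imports Defs begin

text \<open>
  Every interaction set of \<open>U\<close> lies in a single layer \<open>{r * monomial d p x | x \<in> lattice d}\<close>, on which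
  \<open>U\<close> restricts to \<open>V\<close>. Hence the Gibbs weights of \<open>U\<close> factorize over the layers, and the product
  of copies of \<open>\<mu>V\<close> is a Gibbs measure for \<open>U\<close>. Conversely, let \<open>\<mu>\<close> be any Gibbs measure for \<open>U\<close>
  and \<open>D\<close> an event of positive probability that depends only on the other layers. The law of a
  layer under \<open>\<mu>\<close> conditioned on \<open>D\<close> satisfies the Gibbs equations for \<open>V\<close>, because \<open>D\<close> is measurable
  outside every finite subset of that layer. By layer uniqueness this law is \<open>\<mu>V\<close> whatever \<open>D\<close> is,
  so the layers are independent with law \<open>\<mu>V\<close>, which determines \<open>\<mu>\<close>.
\<close>

section \<open>Gibbs measures on countable site sets\<close>

text \<open>The Gibbs property is an almost-everywhere equality of conditional expectations, over a
  different sigma-algebra for every \<open>\<Lambda>\<close>. In that form it is awkward under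
  push-forward, conditioning and products. It is therefore traded for an integral identity tested on
  events \<open>B\<close> outside \<open>\<Lambda>\<close> (\<open>gibbs_measure_iff\<close>), which
  for existence need only be checked on finite cylinders (\<open>gibbs_measureI\<close>). A layer is
  conditioned on one event \<open>D\<close> of positive probability, not on the full configuration
  of the other layers, so no disintegration enters. Independence only asks for finite intersections
  of layer events; these are built up one layer at a time, and for a null \<open>D\<close> both
  sides vanish. There may be infinitely many layers, but a finite \<open>\<Lambda>\<close> meets
  only finitely many of them. This is why a finite index set \<open>I\<close> containing those
  layers accompanies every factorization. Number theory is confined to the last section: the
  probabilistic argument runs for any bijection between \<open>R \<times> L\<close> and
  \<open>S\<close>.\<close>

lemma space_config_space [simp]: "space (config_space S) = configs S"
  by (simp add: config_space_def configs_def space_PiM)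

lemma finite_configs: "finite A \<Longrightarrow> finite (configs A)"
  unfolding configs_def spins_def by (intro finite_PiE) auto

lemma configs_spins: "\<sigma> \<in> configs S \<Longrightarrow> x \<in> S \<Longrightarrow> \<sigma> x \<in> spins"
  by (auto simp: configs_def)

lemma restrict_configs: "\<sigma> \<in> configs S \<Longrightarrow> A \<subseteq> S \<Longrightarrow> restrict \<sigma> A \<in> configs A"
  by (auto simp: configs_def)

text \<open>The restriction in the second premise admits fillers that are not extensional, such as
  the constant function 1 used below.\<close>

lemma merge_configs:
  assumes "\<xi> \<in> configs A" "restrict \<eta> (S - A) \<in> configs (S - A)" "A \<subseteq> S"
  shows "merge A (S - A) (\<xi>, \<eta>) \<in> configs S"
  unfolding configs_def
proof (rule PiE_I)
  fix x assume "x \<in> S"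
  then show "merge A (S - A) (\<xi>, \<eta>) x \<in> spins"
    using configs_spins[OF assms(1), of x] configs_spins[OF assms(2), of x]
    by (cases "x \<in> A") (auto simp: merge_def)
next
  fix x assume "x \<notin> S"
  then show "merge A (S - A) (\<xi>, \<eta>) x = undefined"
    using assms(3) by (auto simp: merge_def)
qed

lemma measurable_spin:
  assumes "x \<in> S" shows "(\<lambda>\<sigma>. \<sigma> x) \<in> measurable (config_space S) (count_space spins)"
  unfolding config_space_def by (rule measurable_component_singleton[OF assms])

lemma measurable_into_config_space:
  assumes "\<And>s. s \<in> space N \<Longrightarrow> f s \<in> extensional S"
    and "\<And>x. x \<in> S \<Longrightarrow> (\<lambda>s. f s x) \<in> measurable N (count_space spins)"
  shows "f \<in> measurable N (config_space S)"
  unfolding config_space_def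
proof (rule measurable_PiM_single)
  show "f \<in> space N \<rightarrow> (\<Pi>\<^sub>E i\<in>S. space (count_space spins))"
    using assms measurable_space[OF assms(2)] by (auto simp: PiE_iff)
next
  fix A i assume "i \<in> S" "A \<in> sets (count_space spins)"
  then show "{\<omega> \<in> space N. f \<omega> i \<in> A} \<in> sets N"
    using measurable_sets[OF assms(2), of i A] by (simp add: vimage_def Int_def conj_commute)
qed

section \<open>Cylinder events and local functions\<close>

lemma cylinder_sets:
  assumes "finite A" "A \<subseteq> S"
  shows "{\<sigma>\<in>configs S. \<forall>x\<in>A. \<sigma> x \<in> E x} \<in> sets (config_space S)"
proof -
  have "{\<sigma> \<in> space (config_space S). \<forall>x\<in>A. \<sigma> x \<in> E x} \<in> sets (config_space S)"
  proof (rule sets.sets_Collect_finite_All[OF _ assms(1)])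
    fix x assume x: "x \<in> A"
    have "(\<lambda>\<sigma>. \<sigma> x) -` (E x \<inter> spins) \<inter> space (config_space S) \<in> sets (config_space S)"
      using x assms by (intro measurable_sets[OF measurable_spin]) auto
    also have "(\<lambda>\<sigma>. \<sigma> x) -` (E x \<inter> spins) \<inter> space (config_space S)
        = {\<sigma> \<in> space (config_space S). \<sigma> x \<in> E x}"
      using x assms by (auto dest: configs_spins)
    finally show "{\<sigma> \<in> space (config_space S). \<sigma> x \<in> E x} \<in> sets (config_space S)" .
  qed
  then show ?thesis by simp
qed

definition cyl :: "'s set \<Rightarrow> 's set \<Rightarrow> ('s \<Rightarrow> real) \<Rightarrow> ('s \<Rightarrow> real) set" where
  "cyl S A \<xi> = {\<sigma> \<in> configs S. restrict \<sigma> A = \<xi>}"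

lemma cyl_alt:
  assumes "\<xi> \<in> configs A"
  shows "cyl S A \<xi> = {\<sigma> \<in> configs S. \<forall>x\<in>A. \<sigma> x \<in> {\<xi> x}}"
proof -
  have "restrict \<sigma> A = \<xi> \<longleftrightarrow> (\<forall>x\<in>A. \<sigma> x = \<xi> x)" for \<sigma>
    using assms unfolding configs_def
    by (auto simp: fun_eq_iff restrict_def PiE_iff extensional_def)
  then show ?thesis by (auto simp: cyl_def)
qed

lemma cyl_in_sets:
  assumes "finite A" "A \<subseteq> S" "\<xi> \<in> configs A"
  shows "cyl S A \<xi> \<in> sets (config_space S)"
  unfolding cyl_alt[OF assms(3)] by (rule cylinder_sets[OF assms(1,2)])

text \<open>Exactly one cylinder over \<open>A\<close>, that of \<open>restrict \<sigma> A\<close>,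
  contains \<open>\<sigma>\<close>. By locality the spins off \<open>A\<close> do not matter and are
  filled with the arbitrary value 1. The finite sum makes measurability of \<open>f\<close>
  evident.\<close>

lemma local_function_eq_sum:
  fixes f :: "('s \<Rightarrow> real) \<Rightarrow> real"
  assumes "finite A" "A \<subseteq> S"
    and loc: "\<And>\<sigma> \<sigma>'. \<sigma> \<in> configs S \<Longrightarrow> \<sigma>' \<in> configs S \<Longrightarrow> (\<forall>i\<in>A. \<sigma> i = \<sigma>' i) \<Longrightarrow> f \<sigma> = f \<sigma>'"
    and "\<sigma> \<in> configs S"
  shows "f \<sigma> = (\<Sum>\<xi>\<in>configs A. f (merge A (S - A) (\<xi>, \<lambda>_. 1)) * indicator (cyl S A \<xi>) \<sigma>)"
proof -
  have ind: "indicator (cyl S A \<xi>) \<sigma> = (if \<xi> = restrict \<sigma> A then 1 else (0::real))" for \<xi>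
    using assms(4) by (auto simp: cyl_def)
  have "(\<Sum>\<xi>\<in>configs A. f (merge A (S - A) (\<xi>, \<lambda>_. 1)) * indicator (cyl S A \<xi>) \<sigma>)
      = f (merge A (S - A) (restrict \<sigma> A, \<lambda>_. 1))"
  proof -
    have "(\<Sum>\<xi>\<in>configs A. f (merge A (S - A) (\<xi>, \<lambda>_. 1)) * indicator (cyl S A \<xi>) \<sigma>)
        = (\<Sum>\<xi>\<in>configs A. if \<xi> = restrict \<sigma> A then f (merge A (S - A) (\<xi>, \<lambda>_. 1)) else 0)"
      by (intro sum.cong) (auto simp: ind)
    also have "\<dots> = f (merge A (S - A) (restrict \<sigma> A, \<lambda>_. 1))"
      using restrict_configs[OF assms(4,2)] finite_configs[OF assms(1)] by (subst sum.delta) auto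
    finally show ?thesis .
  qed
  also have "\<dots> = f \<sigma>"
  proof (rule loc)
    show "merge A (S - A) (restrict \<sigma> A, \<lambda>_. 1) \<in> configs S"
      by (rule merge_configs[OF restrict_configs[OF assms(4,2)] _ assms(2)])
        (auto simp: configs_def spins_def)
    show "\<forall>i\<in>A. merge A (S - A) (restrict \<sigma> A, \<lambda>_. 1) i = \<sigma> i"
      using assms(2) by (auto simp: merge_def)
  qed (rule assms(4))
  finally show ?thesis by (rule sym)
qed

lemma local_function_measurable:
  fixes f :: "('s \<Rightarrow> real) \<Rightarrow> real"
  assumes "finite A" "A \<subseteq> S"
    and loc: "\<And>\<sigma> \<sigma>'. \<sigma> \<in> configs S \<Longrightarrow> \<sigma>' \<in> configs S \<Longrightarrow> (\<forall>i\<in>A. \<sigma> i = \<sigma>' i) \<Longrightarrow> f \<sigma> = f \<sigma>'"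
  shows "f \<in> borel_measurable (config_space S)"
proof -
  let ?g = "\<lambda>\<sigma>. \<Sum>\<xi>\<in>configs A. f (merge A (S - A) (\<xi>, \<lambda>_. 1)) * indicator (cyl S A \<xi>) \<sigma>"
  have g: "?g \<in> borel_measurable (config_space S)"
    by (intro borel_measurable_sum borel_measurable_times borel_measurable_const
        borel_measurable_indicator cyl_in_sets assms(1,2))
  have "f \<sigma> = ?g \<sigma>" if "\<sigma> \<in> space (config_space S)" for \<sigma>
    by (rule local_function_eq_sum[OF assms(1,2) loc]) (use that in simp_all)
  then show ?thesis
    using g measurable_cong[of "config_space S" f ?g borel] by blast
qed

section \<open>Convergence and measurability of the energy\<close>

lemma potential_local:
  assumes "potential S W" "finite A" "A \<subseteq> S" "\<sigma> \<in> configs S" "\<sigma>' \<in> configs S"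
    and "\<forall>i\<in>A. \<sigma> i = \<sigma>' i"
  shows "W A \<sigma> = W A \<sigma>'"
  using assms unfolding potential_def by blast

text \<open>The \<open>Max\<close> in \<open>potential\<close> ranges over the possibly infinite set
  \<open>configs S\<close>. It is a genuine upper bound only because locality leaves finitely many
  values.\<close>

lemma finite_range_local_function:
  fixes f :: "('s \<Rightarrow> real) \<Rightarrow> real"
  assumes "finite A" "A \<subseteq> S"
    and loc: "\<And>\<sigma> \<sigma>'. \<sigma> \<in> configs S \<Longrightarrow> \<sigma>' \<in> configs S \<Longrightarrow> (\<forall>i\<in>A. \<sigma> i = \<sigma>' i) \<Longrightarrow> f \<sigma> = f \<sigma>'"
  shows "finite (f ` configs S)"
proof (rule finite_subset)
  show "f ` configs S \<subseteq> (\<lambda>\<xi>. f (merge A (S - A) (\<xi>, \<lambda>_. 1))) ` configs A"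
  proof
    fix y assume "y \<in> f ` configs S"
    then obtain \<sigma> where \<sigma>: "\<sigma> \<in> configs S" "y = f \<sigma>" by auto
    have "f \<sigma> = f (merge A (S - A) (restrict \<sigma> A, \<lambda>_. 1))"
    proof (rule loc)
      show "merge A (S - A) (restrict \<sigma> A, \<lambda>_. 1) \<in> configs S"
        by (rule merge_configs[OF restrict_configs[OF \<sigma>(1) assms(2)] _ assms(2)])
          (auto simp: configs_def spins_def)
      show "\<forall>i\<in>A. \<sigma> i = merge A (S - A) (restrict \<sigma> A, \<lambda>_. 1) i"
        using assms(2) by (auto simp: merge_def)
    qed fact
    then show "y \<in> (\<lambda>\<xi>. f (merge A (S - A) (\<xi>, \<lambda>_. 1))) ` configs A"
      unfolding \<sigma>(2) using restrict_configs[OF \<sigma>(1) assms(2)] by (rule image_eqI)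
  qed
qed (use finite_configs[OF assms(1)] in auto)

lemma summable_on_finite_UN:
  fixes f :: "'a \<Rightarrow> 'b::banach"
  assumes "finite I" "\<And>i. i \<in> I \<Longrightarrow> f summable_on (B i)"
  shows "f summable_on (\<Union>i\<in>I. B i)"
  using assms
proof (induction I rule: finite_induct)
  case (insert i I)
  have "f summable_on (\<Union>i\<in>I. B i)" "f summable_on B i"
    by (rule insert.IH, rule insert.prems, simp) (rule insert.prems, simp)
  then have "f summable_on (B i \<union> ((\<Union>i\<in>I. B i) - B i))"
    by (intro summable_on_Un_disjoint summable_on_subset_banach[OF _ Diff_subset]) auto
  then show ?case by simp
qed simp

abbreviation touching :: "'s set \<Rightarrow> 's set \<Rightarrow> 's set set" where
  "touching S \<Lambda> \<equiv> {A. finite A \<and> A \<subseteq> S \<and> A \<inter> \<Lambda> \<noteq> {}}"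

text \<open>The sets touching \<open>\<Lambda>\<close> form a finite union of the families in
  \<open>potential\<close>, one for each site of \<open>\<Lambda>\<close>; the maxima over
  configurations dominate the terms.\<close>

lemma potential_summable:
  assumes "potential S W" "finite \<Lambda>" "\<Lambda> \<subseteq> S" "\<sigma> \<in> configs S"
  shows "(\<lambda>A. W A \<sigma>) summable_on touching S \<Lambda>"
proof -
  let ?M = "\<lambda>A. Max ((\<lambda>\<sigma>. \<bar>W A \<sigma>\<bar>) ` configs S)"
  have "?M summable_on (\<Union>i\<in>\<Lambda>. {A. finite A \<and> A \<subseteq> S \<and> i \<in> A})"
    using assms(1)[unfolded potential_def, THEN conjunct2] assms(3)
    by (intro summable_on_finite_UN[OF assms(2)]) blast
  also have "(\<Union>i\<in>\<Lambda>. {A. finite A \<and> A \<subseteq> S \<and> i \<in> A}) = touching S \<Lambda>" by auto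
  finally have M: "?M summable_on touching S \<Lambda>" .
  have le: "norm (W A \<sigma>) \<le> ?M A" if A: "A \<in> touching S \<Lambda>" for A
  proof -
    have "finite ((\<lambda>\<sigma>. \<bar>W A \<sigma>\<bar>) ` configs S)"
    proof (rule finite_range_local_function[of A])
      show "\<bar>W A \<sigma>\<bar> = \<bar>W A \<sigma>'\<bar>"
        if "\<sigma> \<in> configs S" "\<sigma>' \<in> configs S" "\<forall>i\<in>A. \<sigma> i = \<sigma>' i" for \<sigma> \<sigma>'
        using potential_local[OF assms(1) _ _ that] A by (intro arg_cong[of _ _ abs]) blast
    qed (use A in auto)
    then show ?thesis
      unfolding real_norm_def using assms(4) by (intro Max_ge) auto
  qed
  show ?thesis
    by (rule abs_summable_summable, rule summable_on_comparison_test[OF M le]) auto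
qed

text \<open>A countable set has only countably many finite subsets, so the unordered sum can be
  enumerated and becomes an ordinary series of local, hence measurable, functions.\<close>

lemma hamiltonian_measurable:
  assumes "potential S W" "countable S" "finite \<Lambda>" "\<Lambda> \<subseteq> S"
  shows "hamiltonian S W \<Lambda> \<in> borel_measurable (config_space S)"
proof -
  let ?T = "touching S \<Lambda>"
  have cT: "countable ?T"
    by (rule countable_subset[OF _ countable_Collect_finite_subset[OF assms(2)]]) auto
  \<comment> \<open>Indices that the enumeration does not reach contribute 0; this also covers a
    finite family of touching sets.\<close>
  let ?F = "\<lambda>n \<sigma>. if n \<in> to_nat_on ?T ` ?T then W (from_nat_into ?T n) \<sigma> else 0"
  have eq: "hamiltonian S W \<Lambda> \<sigma> = (\<Sum>n. ?F n \<sigma>)" if "\<sigma> \<in> configs S" for \<sigma>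
  proof -
    have "((\<lambda>A. W A \<sigma>) has_sum hamiltonian S W \<Lambda> \<sigma>) ?T"
      unfolding hamiltonian_def
      by (rule has_sum_infsum[OF potential_summable[OF assms(1,3,4) that]])
    also have "?this \<longleftrightarrow> (((\<lambda>n. W (from_nat_into ?T n) \<sigma>) \<circ> to_nat_on ?T) has_sum hamiltonian S W \<Lambda> \<sigma>) ?T"
      using cT by (intro has_sum_cong) simp
    also have "\<dots> \<longleftrightarrow> ((\<lambda>n. W (from_nat_into ?T n) \<sigma>) has_sum hamiltonian S W \<Lambda> \<sigma>) (to_nat_on ?T ` ?T)"
      by (rule has_sum_reindex[symmetric]) (rule inj_on_to_nat_on[OF cT])
    also have "\<dots> \<longleftrightarrow> ((\<lambda>n. ?F n \<sigma>) has_sum hamiltonian S W \<Lambda> \<sigma>) UNIV"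
      by (rule has_sum_cong_neutral) auto
    finally show ?thesis
      using has_sum_imp_sums sums_unique by blast
  qed
  have "(\<lambda>\<sigma>. \<Sum>n. ?F n \<sigma>) \<in> borel_measurable (config_space S)"
  proof (rule borel_measurable_suminf)
    fix n
    show "?F n \<in> borel_measurable (config_space S)"
    proof (cases "n \<in> to_nat_on ?T ` ?T")
      case True
      then have "from_nat_into ?T n \<in> ?T" using from_nat_into[of ?T n] by auto
      then have "W (from_nat_into ?T n) \<in> borel_measurable (config_space S)"
        by (intro local_function_measurable[of "from_nat_into ?T n"])
          (auto intro: potential_local[OF assms(1)])
      then show ?thesis using True by simp
    qed simp
  qed
  then show ?thesis using eq by (subst measurable_cong[where g = "\<lambda>\<sigma>. \<Sum>n. ?F n \<sigma>"]) auto
qed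

section \<open>The sigma-algebra outside a set and the Gibbs kernel\<close>

lemma space_outside_algebra [simp]: "space (outside_algebra S \<Lambda>) = configs S"
  by (simp add: outside_algebra_def)

lemma restrict_measurable:
  "A \<subseteq> S \<Longrightarrow> (\<lambda>\<sigma>. restrict \<sigma> A) \<in> measurable (config_space S) (config_space A)"
  unfolding config_space_def by (rule measurable_restrict_subset)

lemma sets_outside_algebra:
  "sets (outside_algebra S \<Lambda>) =
     {(\<lambda>\<sigma>. restrict \<sigma> (S - \<Lambda>)) -` E \<inter> configs S | E. E \<in> sets (config_space (S - \<Lambda>))}"
  unfolding outside_algebra_def
  by (rule sets_vimage_algebra2) (auto intro: restrict_configs)

lemma restrict_measurable_outside:
  "(\<lambda>\<sigma>. restrict \<sigma> (S - \<Lambda>)) \<in> measurable (outside_algebra S \<Lambda>) (config_space (S - \<Lambda>))"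
  unfolding outside_algebra_def
  by (rule measurable_vimage_algebra1) (auto intro: restrict_configs)

lemma outside_algebra_subset: "sets (outside_algebra S \<Lambda>) \<subseteq> sets (config_space S)"
  using measurable_sets[OF restrict_measurable[of "S - \<Lambda>" S]]
  by (auto simp: sets_outside_algebra)

lemma subalgebra_outside_algebra: "subalgebra (config_space S) (outside_algebra S \<Lambda>)"
  using outside_algebra_subset[of S \<Lambda>] by (simp add: subalgebra_def)

lemma measurable_spin_outside:
  assumes "x \<in> S - \<Lambda>"
  shows "(\<lambda>\<sigma>. \<sigma> x) \<in> measurable (outside_algebra S \<Lambda>) (count_space spins)"
  using measurable_compose[OF restrict_measurable_outside measurable_spin[OF assms]] assms
  by simp

text \<open>Merging overwrites the spins of \<open>\<eta>\<close> in \<open>\<Lambda>\<close>, so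
  only outside information is used. Through this map the Gibbs kernel becomes outside-measurable, as
  a conditional probability must be.\<close>

lemma merge_measurable_outside:
  assumes "\<xi> \<in> configs \<Lambda>" "\<Lambda> \<subseteq> S"
  shows "(\<lambda>\<eta>. merge \<Lambda> (S - \<Lambda>) (\<xi>, \<eta>)) \<in> measurable (outside_algebra S \<Lambda>) (config_space S)"
proof (rule measurable_into_config_space)
  show "merge \<Lambda> (S - \<Lambda>) (\<xi>, \<eta>) \<in> extensional S" for \<eta>
    using assms(2) by (auto simp: merge_def extensional_def)
  fix x assume "x \<in> S"
  then show "(\<lambda>\<eta>. merge \<Lambda> (S - \<Lambda>) (\<xi>, \<eta>) x) \<in> measurable (outside_algebra S \<Lambda>) (count_space spins)"
    using configs_spins[OF assms(1)] measurable_spin_outside[of x S \<Lambda>]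
    by (cases "x \<in> \<Lambda>") (auto simp: merge_def)
qed

lemma gibbs_kernel_measurable:
  assumes "potential S W" "countable S" "finite \<Lambda>" "\<Lambda> \<subseteq> S" "\<xi> \<in> configs \<Lambda>"
  shows "gibbs_kernel S W \<Lambda> \<xi> \<in> borel_measurable (outside_algebra S \<Lambda>)"
proof -
  have [measurable]: "(\<lambda>\<eta>. hamiltonian S W \<Lambda> (merge \<Lambda> (S - \<Lambda>) (\<zeta>, \<eta>)))
      \<in> borel_measurable (outside_algebra S \<Lambda>)" if "\<zeta> \<in> configs \<Lambda>" for \<zeta>
    by (rule measurable_compose[OF merge_measurable_outside[OF that assms(4)]
          hamiltonian_measurable[OF assms(1-4)]])
  show ?thesis
    unfolding gibbs_kernel_def[abs_def]
    by (intro borel_measurable_divide borel_measurable_sum borel_measurable_exp[THEN measurable_compose[rotated]]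
        borel_measurable_uminus) (simp_all add: assms)
qed

lemma gibbs_kernel_measurable_config_space:
  assumes "potential S W" "countable S" "finite \<Lambda>" "\<Lambda> \<subseteq> S" "\<xi> \<in> configs \<Lambda>"
  shows "gibbs_kernel S W \<Lambda> \<xi> \<in> borel_measurable (config_space S)"
  by (rule measurable_from_subalg[OF subalgebra_outside_algebra gibbs_kernel_measurable[OF assms]])

text \<open>The normalizing sum contains the numerator as one of its positive terms. No condition on
  \<open>\<eta>\<close> is imposed, so the bounds hold everywhere and give integrability under any
  probability measure.\<close>

lemma gibbs_kernel_bounds:
  assumes "finite \<Lambda>" "\<xi> \<in> configs \<Lambda>"
  shows "0 \<le> gibbs_kernel S W \<Lambda> \<xi> \<eta>" "gibbs_kernel S W \<Lambda> \<xi> \<eta> \<le> 1"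
proof -
  let ?e = "\<lambda>\<zeta>. exp (- hamiltonian S W \<Lambda> (merge \<Lambda> (S - \<Lambda>) (\<zeta>, \<eta>)))"
  have le: "?e \<xi> \<le> sum ?e (configs \<Lambda>)"
    using finite_configs[OF assms(1)] assms(2) by (intro member_le_sum) auto
  moreover have "0 < ?e \<xi>" by simp
  ultimately have "0 < sum ?e (configs \<Lambda>)" by linarith
  then show "0 \<le> gibbs_kernel S W \<Lambda> \<xi> \<eta>" "gibbs_kernel S W \<Lambda> \<xi> \<eta> \<le> 1"
    using le by (auto simp: gibbs_kernel_def)
qed

section \<open>Integral form of the Gibbs property\<close>

text \<open>Integrating the conditional probability over an outside event \<open>B\<close> gives one
  direction. The other is the characterization of conditional expectations by such integrals,
  available because the kernel is itself outside-measurable.\<close>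

lemma gibbs_measure_iff:
  assumes "potential S W" "countable S"
  shows "gibbs_measure S W \<mu> \<longleftrightarrow> prob_space \<mu> \<and> sets \<mu> = sets (config_space S) \<and>
    (\<forall>\<Lambda> \<xi> B. finite \<Lambda> \<longrightarrow> \<Lambda> \<subseteq> S \<longrightarrow> \<xi> \<in> configs \<Lambda> \<longrightarrow> B \<in> sets (outside_algebra S \<Lambda>) \<longrightarrow>
       measure \<mu> (cyl S \<Lambda> \<xi> \<inter> B) = (\<integral>\<eta>. indicator B \<eta> * gibbs_kernel S W \<Lambda> \<xi> \<eta> \<partial>\<mu>))"
proof -
  have main: "(AE \<eta> in \<mu>. real_cond_exp \<mu> (outside_algebra S \<Lambda>) (indicator (cyl S \<Lambda> \<xi>)) \<eta>
          = gibbs_kernel S W \<Lambda> \<xi> \<eta>) \<longleftrightarrow>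
      (\<forall>B\<in>sets (outside_algebra S \<Lambda>).
         measure \<mu> (cyl S \<Lambda> \<xi> \<inter> B) = (\<integral>\<eta>. indicator B \<eta> * gibbs_kernel S W \<Lambda> \<xi> \<eta> \<partial>\<mu>))"
    (is "?L \<longleftrightarrow> ?R")
    if \<mu>: "prob_space \<mu>" "sets \<mu> = sets (config_space S)"
      and \<Lambda>: "finite \<Lambda>" "\<Lambda> \<subseteq> S" "\<xi> \<in> configs \<Lambda>" for \<Lambda> \<xi>
  proof -
    interpret prob_space \<mu> by fact
    have space: "space \<mu> = configs S" using sets_eq_imp_space_eq[OF \<mu>(2)] by simp
    have sub: "subalgebra \<mu> (outside_algebra S \<Lambda>)"
      using outside_algebra_subset[of S \<Lambda>] by (simp add: subalgebra_def space \<mu>(2))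
    interpret F: finite_measure_subalgebra \<mu> "outside_algebra S \<Lambda>"
      by unfold_locales (rule sub)
    have C: "cyl S \<Lambda> \<xi> \<in> sets \<mu>" using cyl_in_sets[OF \<Lambda>] \<mu>(2) by simp
    have int1: "integrable \<mu> (indicator (cyl S \<Lambda> \<xi>) :: _ \<Rightarrow> real)"
      using C by (intro integrable_real_indicator) (auto simp: less_top[symmetric])
    note Kmeas = gibbs_kernel_measurable[OF assms \<Lambda>]
    have int2: "integrable \<mu> (gibbs_kernel S W \<Lambda> \<xi>)"
      by (rule integrable_const_bound[of _ 1])
        (use gibbs_kernel_bounds[OF \<Lambda>(1,3), of S W] measurable_from_subalg[OF sub Kmeas] in auto)
    have lhs: "measure \<mu> (cyl S \<Lambda> \<xi> \<inter> B) = (LINT \<eta>:B|\<mu>. indicator (cyl S \<Lambda> \<xi>) \<eta>)"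
      if "B \<in> sets (outside_algebra S \<Lambda>)" for B
    proof -
      have "B \<in> sets \<mu>" using that sub by (auto simp: subalgebra_def)
      then show ?thesis
        unfolding set_lebesgue_integral_def using C sets.sets_into_space[OF C]
        by (auto simp: indicator_inter_arith[symmetric] Int_absorb2 Int_ac)
    qed
    show ?thesis
    proof
      assume L: ?L
      show ?R
      proof
        fix B assume B: "B \<in> sets (outside_algebra S \<Lambda>)"
        have "measure \<mu> (cyl S \<Lambda> \<xi> \<inter> B)
            = (LINT \<eta>:B|\<mu>. real_cond_exp \<mu> (outside_algebra S \<Lambda>) (indicator (cyl S \<Lambda> \<xi>)) \<eta>)"
          unfolding lhs[OF B] by (rule F.real_cond_exp_intA[OF int1 B])
        also have "\<dots> = (LINT \<eta>:B|\<mu>. gibbs_kernel S W \<Lambda> \<xi> \<eta>)"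
          unfolding set_lebesgue_integral_def
        proof (rule integral_cong_AE)
          have [measurable]: "B \<in> sets \<mu>" "gibbs_kernel S W \<Lambda> \<xi> \<in> borel_measurable \<mu>"
            using B sub measurable_from_subalg[OF sub Kmeas] by (auto simp: subalgebra_def)
          show "(\<lambda>x. indicat_real B x *\<^sub>R real_cond_exp \<mu> (outside_algebra S \<Lambda>) (indicat_real (cyl S \<Lambda> \<xi>)) x)
              \<in> borel_measurable \<mu>" by measurable
          show "(\<lambda>x. indicat_real B x *\<^sub>R gibbs_kernel S W \<Lambda> \<xi> x) \<in> borel_measurable \<mu>"
            by measurable
        qed (use L in auto)
        finally show "measure \<mu> (cyl S \<Lambda> \<xi> \<inter> B) = (\<integral>\<eta>. indicator B \<eta> * gibbs_kernel S W \<Lambda> \<xi> \<eta> \<partial>\<mu>)"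
          by (simp add: set_lebesgue_integral_def)
      qed
    next
      assume R: ?R
      show ?L
        by (rule F.real_cond_exp_charact[OF _ int1 int2 Kmeas])
          (use R lhs in \<open>simp add: set_lebesgue_integral_def\<close>)
    qed
  qed
  show ?thesis
    unfolding gibbs_measure_def cyl_def[symmetric]
    by (intro conj_cong refl) (use main in auto)
qed

text \<open>Both sides of the equation in \<open>gibbs_measure_iff\<close> are finite measures as functions of \<open>B\<close>,
  so cylinder events suffice.\<close>

lemma gibbs_measureI:
  assumes "potential S W" "countable S" "prob_space \<mu>" "sets \<mu> = sets (config_space S)"
    and eq: "\<And>\<Lambda> \<xi> \<Delta> E. finite \<Lambda> \<Longrightarrow> \<Lambda> \<subseteq> S \<Longrightarrow> \<xi> \<in> configs \<Lambda> \<Longrightarrow> finite \<Delta> \<Longrightarrow> \<Delta> \<subseteq> S - \<Lambda> \<Longrightarrow>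
       measure \<mu> (cyl S \<Lambda> \<xi> \<inter> {\<sigma> \<in> configs S. \<forall>x\<in>\<Delta>. \<sigma> x \<in> E x}) =
       (\<integral>\<eta>. indicator {\<sigma> \<in> configs S. \<forall>x\<in>\<Delta>. \<sigma> x \<in> E x} \<eta> * gibbs_kernel S W \<Lambda> \<xi> \<eta> \<partial>\<mu>)"
  shows "gibbs_measure S W \<mu>"
  unfolding gibbs_measure_iff[OF assms(1,2)]
proof (intro conjI allI impI assms(3,4))
  fix \<Lambda> \<xi> B
  assume \<Lambda>: "finite \<Lambda>" "\<Lambda> \<subseteq> S" "\<xi> \<in> configs \<Lambda>" and B: "B \<in> sets (outside_algebra S \<Lambda>)"
  interpret prob_space \<mu> by fact
  have space: "space \<mu> = configs S" using sets_eq_imp_space_eq[OF assms(4)] by simp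
  have sub: "subalgebra \<mu> (outside_algebra S \<Lambda>)"
    using outside_algebra_subset[of S \<Lambda>] by (simp add: subalgebra_def space assms(4))
  let ?N = "config_space (S - \<Lambda>)" and ?\<rho> = "\<lambda>\<sigma>. restrict \<sigma> (S - \<Lambda>)"
  let ?K = "gibbs_kernel S W \<Lambda> \<xi>"
  have C[measurable]: "cyl S \<Lambda> \<xi> \<in> sets \<mu>" using cyl_in_sets[OF \<Lambda>] assms(4) by simp
  have K[measurable]: "?K \<in> borel_measurable \<mu>"
    by (rule measurable_from_subalg[OF sub gibbs_kernel_measurable[OF assms(1,2) \<Lambda>]])
  note bounds = gibbs_kernel_bounds[OF \<Lambda>(1,3), of S W]
  have \<rho>: "?\<rho> \<in> measurable \<mu> ?N"
    using restrict_measurable[of "S - \<Lambda>" S] by (simp add: measurable_cong_sets[OF assms(4) refl])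
  \<comment> \<open>\<open>P\<close> and \<open>Q\<close> are the two sides of the Gibbs equation as
    measures on outside configurations: \<open>\<mu>\<close> weighted by the cylinder event and by
    the kernel, respectively. Finite measures on an infinite product agree once they agree on
    finite-dimensional cylinders.\<close>
  define P where "P = distr (density \<mu> (indicator (cyl S \<Lambda> \<xi>))) ?N ?\<rho>"
  define Q where "Q = distr (density \<mu> (\<lambda>\<eta>. ennreal (?K \<eta>))) ?N ?\<rho>"
  have sets_eq: "sets P = sets ?N" "sets Q = sets ?N" by (auto simp: P_def Q_def)
  have P: "emeasure P E = ennreal (measure \<mu> (cyl S \<Lambda> \<xi> \<inter> (?\<rho> -` E \<inter> configs S)))"
    if "E \<in> sets ?N" for E
  proof -
    have [measurable]: "?\<rho> -` E \<inter> space \<mu> \<in> sets \<mu>" by (rule measurable_sets[OF \<rho> that])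
    have "emeasure P E = (\<integral>\<^sup>+\<eta>. indicator (cyl S \<Lambda> \<xi> \<inter> (?\<rho> -` E \<inter> space \<mu>)) \<eta> \<partial>\<mu>)"
      using that \<rho> by (simp add: P_def emeasure_distr emeasure_density indicator_inter_arith)
    also have "\<dots> = emeasure \<mu> (cyl S \<Lambda> \<xi> \<inter> (?\<rho> -` E \<inter> space \<mu>))"
      by (intro nn_integral_indicator) measurable
    finally show ?thesis by (simp add: emeasure_eq_measure space)
  qed
  have Q: "emeasure Q E = ennreal (\<integral>\<eta>. indicator (?\<rho> -` E \<inter> configs S) \<eta> * ?K \<eta> \<partial>\<mu>)"
    if "E \<in> sets ?N" for E
  proof -
    have [measurable]: "?\<rho> -` E \<inter> space \<mu> \<in> sets \<mu>" by (rule measurable_sets[OF \<rho> that])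
    have "emeasure Q E = (\<integral>\<^sup>+\<eta>. ennreal (indicator (?\<rho> -` E \<inter> space \<mu>) \<eta> * ?K \<eta>) \<partial>\<mu>)"
      using that \<rho> by (auto simp: Q_def emeasure_distr emeasure_density indicator_def intro!: nn_integral_cong)
    also have "\<dots> = ennreal (\<integral>\<eta>. indicator (?\<rho> -` E \<inter> space \<mu>) \<eta> * ?K \<eta> \<partial>\<mu>)"
    proof (rule nn_integral_eq_integral)
      show "integrable \<mu> (\<lambda>\<eta>. indicator (?\<rho> -` E \<inter> space \<mu>) \<eta> * ?K \<eta>)"
        by (rule integrable_const_bound[of _ 1], use bounds in \<open>simp add: indicator_def\<close>) measurable
    qed (use bounds in auto)
    finally show ?thesis by (simp add: space)
  qed
  have "P = Q"
  proof (rule measure_eqI_PiM_infinite[of _ "S - \<Lambda>" "\<lambda>_. count_space spins"])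
    show "sets P = sets (PiM (S - \<Lambda>) (\<lambda>_. count_space spins))"
      "sets Q = sets (PiM (S - \<Lambda>) (\<lambda>_. count_space spins))"
      using sets_eq by (simp_all add: config_space_def)
    show "finite_measure P"
      by (rule finite_measureI) (simp add: P sets_eq_imp_space_eq[OF sets_eq(1)] sets.top[of ?N, simplified])
  next
    fix E J assume J: "finite J" "J \<subseteq> S - \<Lambda>" and E: "\<And>i. i \<in> J \<Longrightarrow> E i \<in> sets (count_space spins)"
    let ?X = "prod_emb (S - \<Lambda>) (\<lambda>_. count_space spins) J (Pi\<^sub>E J E)"
    have X: "?X \<in> sets ?N"
      unfolding config_space_def using J E by (intro sets_PiM_I) auto
    have "?\<rho> -` ?X \<inter> configs S = {\<sigma> \<in> configs S. \<forall>x\<in>J. \<sigma> x \<in> E x}"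
      using J restrict_configs[of _ S "S - \<Lambda>"]
      by (auto simp: prod_emb_def PiE_iff configs_def subset_iff restrict_def extensional_def)
    then show "emeasure P ?X = emeasure Q ?X"
      unfolding P[OF X] Q[OF X] using eq[OF \<Lambda> J, of E] by simp
  qed
  moreover obtain E where E: "E \<in> sets ?N" "B = ?\<rho> -` E \<inter> configs S"
    using B by (auto simp: sets_outside_algebra)
  ultimately have "ennreal (measure \<mu> (cyl S \<Lambda> \<xi> \<inter> B)) = ennreal (\<integral>\<eta>. indicator B \<eta> * ?K \<eta> \<partial>\<mu>)"
    using P[OF E(1)] Q[OF E(1)] by simp
  \<comment> \<open>\<open>ennreal\<close> collapses negative reals to 0, so the equation descends
    to the reals only for nonnegative sides.\<close>
  moreover have "0 \<le> (\<integral>\<eta>. indicator B \<eta> * ?K \<eta> \<partial>\<mu>)"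
    using bounds by (intro integral_nonneg_AE) (auto simp: indicator_def)
  ultimately show "measure \<mu> (cyl S \<Lambda> \<xi> \<inter> B) = (\<integral>\<eta>. indicator B \<eta> * ?K \<eta> \<partial>\<mu>)"
    by (simp add: ennreal_inj)
qed

section \<open>Non-interacting layers\<close>

text \<open>Sites are addressed by a layer index in \<open>R\<close> and a position in
  \<open>L\<close>. Nonemptiness of \<open>R\<close> provides a layer through which properties of
  \<open>S\<close>, such as countability, pass to \<open>L\<close>.\<close>

locale layered_sites =
  fixes S :: "'s set" and L :: "'t set" and R :: "'r set" and emb :: "'r \<Rightarrow> 't \<Rightarrow> 's"
  assumes bij_emb: "bij_betw (\<lambda>(r, x). emb r x) (R \<times> L) S"
    and countable_sites: "countable S"
    and layers_nonempty: "R \<noteq> {}"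
begin

definition coords :: "'s \<Rightarrow> 'r \<times> 't" where
  "coords = the_inv_into (R \<times> L) (\<lambda>(r, x). emb r x)"

definition layer :: "'r \<Rightarrow> ('s \<Rightarrow> real) \<Rightarrow> 't \<Rightarrow> real" where
  "layer r \<sigma> = (\<lambda>x\<in>L. \<sigma> (emb r x))"

definition slice :: "'s set \<Rightarrow> 'r \<Rightarrow> 't set" where
  "slice \<Lambda> r = {x \<in> L. emb r x \<in> \<Lambda>}"

definition local_layer :: "'s set \<Rightarrow> 'r \<Rightarrow> ('s \<Rightarrow> real) \<Rightarrow> 't \<Rightarrow> real" where
  "local_layer \<Lambda> r \<xi> = (\<lambda>x\<in>slice \<Lambda> r. \<xi> (emb r x))"

text \<open>For \<open>\<Lambda> = S\<close> this inverts the passage from a configuration to the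
  family of its layers. For finite \<open>\<Lambda>\<close> it assembles a local configuration from
  its pieces on the slices.\<close>

definition glue :: "'s set \<Rightarrow> ('r \<Rightarrow> 't \<Rightarrow> real) \<Rightarrow> 's \<Rightarrow> real" where
  "glue \<Lambda> t = (\<lambda>s\<in>\<Lambda>. t (fst (coords s)) (snd (coords s)))"

lemma emb_in: "r \<in> R \<Longrightarrow> x \<in> L \<Longrightarrow> emb r x \<in> S"
  using bij_emb by (auto simp: bij_betw_def)

lemma coords_emb: "r \<in> R \<Longrightarrow> x \<in> L \<Longrightarrow> coords (emb r x) = (r, x)"
  using the_inv_into_f_f[of "\<lambda>(r, x). emb r x" "R \<times> L" "(r, x)"] bij_emb
  by (simp add: coords_def bij_betw_def)

lemma emb_eq_iff:
  assumes "r \<in> R" "x \<in> L" "r' \<in> R" "x' \<in> L"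
  shows "emb r x = emb r' x' \<longleftrightarrow> r = r' \<and> x = x'"
  using coords_emb[OF assms(1,2)] coords_emb[OF assms(3,4)] by (metis prod.inject)

lemma emb_inj: "r \<in> R \<Longrightarrow> inj_on (emb r) L"
  by (auto simp: inj_on_def emb_eq_iff)

lemma emb_cases:
  assumes "s \<in> S" obtains r x where "r \<in> R" "x \<in> L" "s = emb r x"
  using assms bij_emb by (auto simp: bij_betw_def image_iff)

lemma coords_in:
  assumes "s \<in> S"
  shows "fst (coords s) \<in> R" "snd (coords s) \<in> L" "emb (fst (coords s)) (snd (coords s)) = s"
  using assms by (auto elim!: emb_cases simp: coords_emb)

lemma countable_layer: "countable L"
proof -
  obtain r where "r \<in> R" using layers_nonempty by auto
  then have "emb r ` L \<subseteq> S" "inj_on (emb r) L" using emb_in emb_inj by auto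
  then show ?thesis
    using countable_sites countable_subset countable_image_inj_on by metis
qed

lemma slice_subset: "slice \<Lambda> r \<subseteq> L" by (auto simp: slice_def)

lemma finite_slice: "r \<in> R \<Longrightarrow> finite \<Lambda> \<Longrightarrow> finite (slice \<Lambda> r)"
  by (rule inj_on_finite[OF inj_on_subset[OF emb_inj slice_subset]]) (auto simp: slice_def)

lemma slice_emb_image: "r \<in> R \<Longrightarrow> \<Lambda> \<subseteq> L \<Longrightarrow> slice (emb r ` \<Lambda>) r = \<Lambda>"
  by (force simp: slice_def emb_eq_iff subset_iff)

lemma layer_configs: "\<sigma> \<in> configs S \<Longrightarrow> r \<in> R \<Longrightarrow> layer r \<sigma> \<in> configs L"
  by (auto simp: layer_def configs_def intro!: emb_in)

lemma local_layer_configs: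
  "\<xi> \<in> configs \<Lambda> \<Longrightarrow> local_layer \<Lambda> r \<xi> \<in> configs (slice \<Lambda> r)"
  by (auto simp: local_layer_def configs_def slice_def)

lemma glue_emb: "r \<in> R \<Longrightarrow> x \<in> L \<Longrightarrow> emb r x \<in> \<Lambda> \<Longrightarrow> glue \<Lambda> t (emb r x) = t r x"
  by (simp add: glue_def coords_emb)

lemma glue_configs:
  assumes "\<Lambda> \<subseteq> S" "\<And>r x. r \<in> R \<Longrightarrow> x \<in> slice \<Lambda> r \<Longrightarrow> t r x \<in> spins"
  shows "glue \<Lambda> t \<in> configs \<Lambda>"
  unfolding glue_def configs_def
proof (rule restrict_PiE_iff[THEN iffD2], rule ballI)
  fix s assume s: "s \<in> \<Lambda>"
  then have "s \<in> S" using assms(1) by auto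
  from coords_in[OF this] s show "t (fst (coords s)) (snd (coords s)) \<in> spins"
    by (intro assms(2)) (auto simp: slice_def)
qed

lemma layer_glue: "r \<in> R \<Longrightarrow> t r \<in> extensional L \<Longrightarrow> layer r (glue S t) = t r"
  by (auto simp: layer_def glue_emb emb_in extensional_def fun_eq_iff)

lemma glue_layers:
  assumes "\<sigma> \<in> configs S" shows "glue S (\<lambda>r\<in>R. layer r \<sigma>) = \<sigma>"
proof
  fix s show "glue S (\<lambda>r\<in>R. layer r \<sigma>) s = \<sigma> s"
    using assms coords_in[of s] by (auto simp: glue_def layer_def configs_def PiE_iff extensional_def)
qed

text \<open>Surjectivity comes from repeating the same \<open>\<tau>\<close> in all layers. It lets
  statements about \<open>V\<close> on all of \<open>configs L\<close> be read off from
  \<open>U\<close>.\<close>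

lemma layer_image_configs:
  assumes "r \<in> R" shows "layer r ` configs S = configs L"
proof
  show "layer r ` configs S \<subseteq> configs L" using assms layer_configs by auto
  show "configs L \<subseteq> layer r ` configs S"
  proof
    fix \<tau> assume \<tau>: "\<tau> \<in> configs L"
    have "glue S (\<lambda>_. \<tau>) \<in> configs S"
      using configs_spins[OF \<tau>] slice_subset by (intro glue_configs) auto
    moreover have "layer r (glue S (\<lambda>_. \<tau>)) = \<tau>"
      using \<tau> by (intro layer_glue[OF assms]) (simp add: configs_def PiE_iff)
    ultimately show "\<tau> \<in> layer r ` configs S" by (intro image_eqI[of _ _ "glue S (\<lambda>_. \<tau>)"]) simp_all
  qed
qed

lemma layer_merge:
  assumes "r \<in> R"
  shows "layer r (merge \<Lambda> (S - \<Lambda>) (\<xi>, \<eta>))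
    = merge (slice \<Lambda> r) (L - slice \<Lambda> r) (local_layer \<Lambda> r \<xi>, layer r \<eta>)"
  using assms by (auto simp: layer_def merge_def slice_def local_layer_def fun_eq_iff emb_in)

lemma layer_measurable:
  assumes "r \<in> R" shows "layer r \<in> measurable (config_space S) (config_space L)"
proof (rule measurable_into_config_space)
  fix x assume "x \<in> L"
  then show "(\<lambda>\<sigma>. layer r \<sigma> x) \<in> measurable (config_space S) (count_space spins)"
    using assms measurable_spin[of "emb r x" S] by (simp add: layer_def emb_in)
qed (simp add: layer_def)

lemma layer_measurable_outside:
  assumes "r \<in> R" "\<And>x. x \<in> L \<Longrightarrow> emb r x \<notin> \<Lambda>"
  shows "layer r \<in> measurable (outside_algebra S \<Lambda>) (config_space L)"
proof (rule measurable_into_config_space)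
  fix x assume "x \<in> L"
  then show "(\<lambda>\<sigma>. layer r \<sigma> x) \<in> measurable (outside_algebra S \<Lambda>) (count_space spins)"
    using assms measurable_spin_outside[of "emb r x" S \<Lambda>] by (simp add: layer_def emb_in)
qed (simp add: layer_def)

text \<open>A spin of layer \<open>r\<close> off the slice is a spin of \<open>S\<close> off
  \<open>\<Lambda>\<close>. Hence a test event for the Gibbs equation of \<open>V\<close> pulls back
  to a test event for that of \<open>U\<close>.\<close>

lemma layer_measurable_outside_slice:
  assumes "r \<in> R"
  shows "layer r \<in> measurable (outside_algebra S \<Lambda>) (outside_algebra L (slice \<Lambda> r))"
  unfolding outside_algebra_def[of L]
proof (rule measurable_vimage_algebra2)
  show "layer r \<in> space (outside_algebra S \<Lambda>) \<rightarrow> configs L" using assms layer_configs by auto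
  show "(\<lambda>\<sigma>. restrict (layer r \<sigma>) (L - slice \<Lambda> r))
      \<in> measurable (outside_algebra S \<Lambda>) (config_space (L - slice \<Lambda> r))"
  proof (rule measurable_into_config_space)
    fix x assume "x \<in> L - slice \<Lambda> r"
    then show "(\<lambda>\<sigma>. restrict (layer r \<sigma>) (L - slice \<Lambda> r) x)
        \<in> measurable (outside_algebra S \<Lambda>) (count_space spins)"
      using assms measurable_spin_outside[of "emb r x" S \<Lambda>]
      by (simp add: layer_def emb_in slice_def)
  qed simp
qed

lemma glue_measurable: "glue S \<in> measurable (PiM R (\<lambda>_. config_space L)) (config_space S)"
proof (rule measurable_into_config_space)
  fix s assume "s \<in> S"
  then show "(\<lambda>t. glue S t s) \<in> measurable (PiM R (\<lambda>_. config_space L)) (count_space spins)"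
    using measurable_compose[OF measurable_component_singleton[of "fst (coords s)" R "\<lambda>_. config_space L"]
        measurable_spin[of "snd (coords s)" L]] coords_in[of s]
    by (simp add: glue_def)
qed (simp add: glue_def)

text \<open>The set \<open>I\<close> must contain every layer that meets \<open>\<Lambda>\<close>
  but may be larger: over an empty slice the cylinder is all of \<open>configs L\<close>. It is used
  with a single layer and with the layers met by two finite sets.\<close>

lemma cyl_layers:
  assumes "\<Lambda> \<subseteq> S" "\<xi> \<in> configs \<Lambda>" "I \<subseteq> R" "\<And>r. r \<in> R - I \<Longrightarrow> slice \<Lambda> r = {}"
  shows "\<sigma> \<in> cyl S \<Lambda> \<xi> \<longleftrightarrow>
    \<sigma> \<in> configs S \<and> (\<forall>r\<in>I. layer r \<sigma> \<in> cyl L (slice \<Lambda> r) (local_layer \<Lambda> r \<xi>))"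
proof -
  have "(\<forall>s\<in>\<Lambda>. \<sigma> s = \<xi> s) \<longleftrightarrow> (\<forall>r\<in>I. \<forall>x\<in>slice \<Lambda> r. \<sigma> (emb r x) = \<xi> (emb r x))" (is "?A \<longleftrightarrow> ?B")
  proof
    assume B: ?B
    show ?A
    proof
      fix s assume s: "s \<in> \<Lambda>"
      then obtain r x where rx: "r \<in> R" "x \<in> L" "s = emb r x" using assms(1) emb_cases[of s] by blast
      then have "x \<in> slice \<Lambda> r" using s by (simp add: slice_def)
      moreover from this have "r \<in> I" using assms(4)[of r] rx by auto
      ultimately show "\<sigma> s = \<xi> s" using B rx by auto
    qed
  qed (auto simp: slice_def)
  moreover have "layer r \<sigma> x = \<sigma> (emb r x)" "local_layer \<Lambda> r \<xi> x = \<xi> (emb r x)"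
    if "x \<in> slice \<Lambda> r" for r x
    using that slice_subset by (auto simp: layer_def local_layer_def)
  ultimately show ?thesis
    using assms(3) layer_configs
    by (auto simp: cyl_alt[OF assms(2)] cyl_alt[OF local_layer_configs[OF assms(2)]])
qed

end

section \<open>Factorization of energies and kernels over the layers\<close>

locale layered_potential = layered_sites S L R emb
  for S :: "'s set" and L :: "'t set" and R :: "'r set" and emb :: "'r \<Rightarrow> 't \<Rightarrow> 's" +
  fixes U :: "'s set \<Rightarrow> ('s \<Rightarrow> real) \<Rightarrow> real" and V :: "'t set \<Rightarrow> ('t \<Rightarrow> real) \<Rightarrow> real"
  assumes potential_U: "potential S U"
    and U_layer: "\<And>r B \<sigma>. r \<in> R \<Longrightarrow> finite B \<Longrightarrow> B \<subseteq> L \<Longrightarrow> \<sigma> \<in> configs S \<Longrightarrow>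
      U (emb r ` B) \<sigma> = V B (layer r \<sigma>)"
    and U_cross: "\<And>B \<sigma>. finite B \<Longrightarrow> B \<subseteq> S \<Longrightarrow> (\<And>r. r \<in> R \<Longrightarrow> \<not> B \<subseteq> emb r ` L) \<Longrightarrow>
      \<sigma> \<in> configs S \<Longrightarrow> U B \<sigma> = 0"
begin

text \<open>Both conditions are inherited through one fixed layer: the finite subsets of
  \<open>L\<close> embed injectively into those of \<open>S\<close>, and the maxima of
  \<open>U\<close> and \<open>V\<close> coincide because \<open>layer r\<close> is onto.\<close>

lemma potential_V: "potential L V"
proof -
  obtain r where r: "r \<in> R" using layers_nonempty by auto
  show ?thesis
    unfolding potential_def
  proof (intro conjI allI ballI impI)
    fix A \<tau> \<tau>'
    assume A: "finite A" "A \<subseteq> L" and \<tau>: "\<tau> \<in> configs L" "\<tau>' \<in> configs L"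
      and eq: "\<forall>i\<in>A. \<tau> i = \<tau>' i"
    from \<tau> obtain \<sigma> \<sigma>' where \<sigma>: "\<sigma> \<in> configs S" "\<tau> = layer r \<sigma>" "\<sigma>' \<in> configs S" "\<tau>' = layer r \<sigma>'"
      unfolding layer_image_configs[OF r, symmetric] by auto
    have "U (emb r ` A) \<sigma> = U (emb r ` A) \<sigma>'"
    proof (rule potential_local[OF potential_U])
      show "\<forall>i\<in>emb r ` A. \<sigma> i = \<sigma>' i"
      proof
        fix i assume "i \<in> emb r ` A"
        then obtain x where "x \<in> A" "i = emb r x" by auto
        then show "\<sigma> i = \<sigma>' i" using eq[unfolded \<sigma>, rule_format, of x] A(2) by (auto simp: layer_def)
      qed
    qed (use A r \<sigma> emb_in in auto)
    then show "V A \<tau> = V A \<tau>'"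
      unfolding U_layer[OF r A \<sigma>(1)] U_layer[OF r A \<sigma>(3)] \<sigma> .
  next
    fix x assume x: "x \<in> L"
    let ?MU = "\<lambda>A. Max ((\<lambda>\<sigma>. \<bar>U A \<sigma>\<bar>) ` configs S)"
    let ?MV = "\<lambda>A. Max ((\<lambda>\<tau>. \<bar>V A \<tau>\<bar>) ` configs L)"
    let ?F = "{A. finite A \<and> A \<subseteq> L \<and> x \<in> A}"
    have "?MU summable_on {A. finite A \<and> A \<subseteq> S \<and> emb r x \<in> A}"
      using potential_U[unfolded potential_def, THEN conjunct2] emb_in[OF r x] by blast
    then have "?MU summable_on (`) (emb r) ` ?F"
      by (rule summable_on_subset_banach) (use r emb_in in auto)
    moreover have "inj_on ((`) (emb r)) ?F"
      using inj_on_image_Pow[OF emb_inj[OF r]] by (rule inj_on_subset) auto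
    ultimately have "(?MU \<circ> (`) (emb r)) summable_on ?F"
      by (simp add: summable_on_reindex)
    also have "?this \<longleftrightarrow> ?MV summable_on ?F"
    proof (rule summable_on_cong)
      fix A assume "A \<in> ?F"
      then have "(\<lambda>\<sigma>. \<bar>U (emb r ` A) \<sigma>\<bar>) ` configs S = (\<lambda>\<sigma>. \<bar>V A (layer r \<sigma>)\<bar>) ` configs S"
        using r by (intro image_cong refl) (simp add: U_layer)
      also have "\<dots> = (\<lambda>\<tau>. \<bar>V A \<tau>\<bar>) ` configs L"
        unfolding layer_image_configs[OF r, symmetric] by (simp add: image_image)
      finally show "(?MU \<circ> (`) (emb r)) A = ?MV A" by simp
    qed
    finally show "?MV summable_on ?F" .
  qed
qed

text \<open>A touching set lies in exactly one layer or in none. The latter contribute nothing by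
  \<open>U_cross\<close>; the former split the sum into disjoint families, each a reindexed energy
  of \<open>V\<close>.\<close>

lemma hamiltonian_layers:
  assumes "finite \<Lambda>" "\<Lambda> \<subseteq> S" "\<sigma> \<in> configs S" "finite I" "I \<subseteq> R" "\<And>r. r \<in> R - I \<Longrightarrow> slice \<Lambda> r = {}"
  shows "hamiltonian S U \<Lambda> \<sigma> = (\<Sum>r\<in>I. hamiltonian L V (slice \<Lambda> r) (layer r \<sigma>))"
proof -
  let ?f = "\<lambda>A. U A \<sigma>" and ?T = "touching S \<Lambda>"
  let ?B = "\<lambda>r. (`) (emb r) ` touching L (slice \<Lambda> r)"
  have sub: "?B r \<subseteq> ?T" if "r \<in> I" for r
    using that assms(5) emb_in by (auto simp: slice_def)
  \<comment> \<open>If \<open>A\<close> lay in a layer \<open>r\<close>, then meeting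
    \<open>\<Lambda>\<close> would make the slice nonempty, put \<open>r\<close> into
    \<open>I\<close>, and list \<open>A\<close> among the sets of \<open>?B r\<close>.\<close>
  have zero: "U A \<sigma> = 0" if A: "A \<in> ?T - (\<Union>r\<in>I. ?B r)" for A
  proof (rule U_cross)
    show "\<not> A \<subseteq> emb r ` L" if r: "r \<in> R" for r
    proof
      assume "A \<subseteq> emb r ` L"
      then obtain B where B: "B \<subseteq> L" "A = emb r ` B" by (auto simp: subset_image_iff)
      then have "B \<inter> slice \<Lambda> r \<noteq> {}" using A by (auto simp: slice_def)
      moreover from this have "r \<in> I" using assms(6)[of r] r by auto
      moreover have "finite B"
        using A B inj_on_subset[OF emb_inj[OF r] B(1)] by (auto simp: finite_image_iff)
      ultimately have "A \<in> ?B r" using B by blast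
      with \<open>r \<in> I\<close> A show False by blast
    qed
  qed (use A assms in auto)
  have "hamiltonian S U \<Lambda> \<sigma> = infsum ?f (\<Union>r\<in>I. ?B r)"
    unfolding hamiltonian_def
  proof (rule infsum_cong_neutral)
    show "U A \<sigma> = 0" if A: "A \<in> (\<Union>r\<in>I. ?B r) - ?T" for A
    proof -
      obtain r where r: "r \<in> I" "A \<in> ?B r" and nT: "A \<notin> ?T" using A by blast
      show ?thesis using nT subsetD[OF sub[OF r(1)] r(2)] by contradiction
    qed
  qed (rule zero, assumption, rule refl)
  also have "\<dots> = (\<Sum>r\<in>I. infsum ?f (?B r))"
  proof (rule sum_infsum[symmetric, OF assms(4)])
    show "?f summable_on ?B r" if "r \<in> I" for r
      by (rule summable_on_subset_banach[OF potential_summable[OF potential_U assms(1-3)] sub[OF that]])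
    show "?B r \<inter> ?B r' = {}" if "r \<in> I" "r' \<in> I" "r \<noteq> r'" for r r'
    proof -
      \<comment> \<open>Nonemptiness is essential, as the empty set lies in every layer; touching
        sets satisfy it.\<close>
      have "emb r ` A \<noteq> emb r' ` A'" if "A \<subseteq> L" "A' \<subseteq> L" "A \<noteq> {}" for A A'
        using that emb_eq_iff[of r _ r'] \<open>r \<in> I\<close> \<open>r' \<in> I\<close> \<open>r \<noteq> r'\<close> assms(5) by blast
      then show ?thesis by auto
    qed
  qed
  also have "\<dots> = (\<Sum>r\<in>I. hamiltonian L V (slice \<Lambda> r) (layer r \<sigma>))"
  proof (rule sum.cong[OF refl])
    fix r assume "r \<in> I"
    then have r: "r \<in> R" using assms(5) by auto
    have "inj_on ((`) (emb r)) (touching L (slice \<Lambda> r))"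
      using inj_on_image_Pow[OF emb_inj[OF r]] by (rule inj_on_subset) auto
    then have "infsum ?f (?B r) = infsum (?f \<circ> (`) (emb r)) (touching L (slice \<Lambda> r))"
      by (rule infsum_reindex)
    also have "\<dots> = hamiltonian L V (slice \<Lambda> r) (layer r \<sigma>)"
      unfolding hamiltonian_def by (intro infsum_cong) (use U_layer[OF r _ _ assms(3)] in auto)
    finally show "infsum ?f (?B r) = hamiltonian L V (slice \<Lambda> r) (layer r \<sigma>)" .
  qed
  finally show ?thesis .
qed

text \<open>The exponential turns the sum of layer energies into a product. The normalization
  factorizes by distributivity, since a configuration on \<open>\<Lambda>\<close> is an arbitrary
  choice of one configuration on each slice.\<close>

lemma gibbs_kernel_layers:
  assumes "finite \<Lambda>" "\<Lambda> \<subseteq> S" "\<xi> \<in> configs \<Lambda>" "\<eta> \<in> configs S"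
    and "finite I" "I \<subseteq> R" "\<And>r. r \<in> R - I \<Longrightarrow> slice \<Lambda> r = {}"
  shows "gibbs_kernel S U \<Lambda> \<xi> \<eta>
    = (\<Prod>r\<in>I. gibbs_kernel L V (slice \<Lambda> r) (local_layer \<Lambda> r \<xi>) (layer r \<eta>))"
proof -
  let ?h = "\<lambda>r \<zeta>. exp (- hamiltonian L V (slice \<Lambda> r) (merge (slice \<Lambda> r) (L - slice \<Lambda> r) (\<zeta>, layer r \<eta>)))"
  have weight: "exp (- hamiltonian S U \<Lambda> (merge \<Lambda> (S - \<Lambda>) (\<zeta>, \<eta>))) = (\<Prod>r\<in>I. ?h r (local_layer \<Lambda> r \<zeta>))"
    if "\<zeta> \<in> configs \<Lambda>" for \<zeta>
  proof -
    have "merge \<Lambda> (S - \<Lambda>) (\<zeta>, \<eta>) \<in> configs S"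
      using assms(4) by (intro merge_configs[OF that _ assms(2)] restrict_configs) auto
    from hamiltonian_layers[OF assms(1,2) this assms(5-7)]
    have "hamiltonian S U \<Lambda> (merge \<Lambda> (S - \<Lambda>) (\<zeta>, \<eta>)) = (\<Sum>r\<in>I. hamiltonian L V (slice \<Lambda> r)
        (merge (slice \<Lambda> r) (L - slice \<Lambda> r) (local_layer \<Lambda> r \<zeta>, layer r \<eta>)))"
      using assms(6) by (auto simp: layer_merge intro!: sum.cong)
    then show ?thesis
      by (simp add: exp_sum[OF assms(5)] sum_negf[symmetric])
  qed
  have local_glue: "local_layer \<Lambda> r (glue \<Lambda> g) = g r"
    if "g \<in> (\<Pi>\<^sub>E r\<in>I. configs (slice \<Lambda> r))" "r \<in> I" for g r
  proof -
    have "g r \<in> configs (slice \<Lambda> r)" using that by auto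
    then show ?thesis
      using that(2) assms(6)
      by (auto simp: local_layer_def slice_def glue_emb configs_def PiE_iff extensional_def fun_eq_iff subset_iff)
  qed
  have in_I: "fst (coords s) \<in> I" "snd (coords s) \<in> slice \<Lambda> (fst (coords s))" if "s \<in> \<Lambda>" for s
  proof -
    have s: "s \<in> S" using that assms(2) by auto
    show sl: "snd (coords s) \<in> slice \<Lambda> (fst (coords s))"
      using coords_in[OF s] that by (simp add: slice_def)
    show "fst (coords s) \<in> I"
      using assms(7)[of "fst (coords s)"] coords_in[OF s] sl by blast
  qed
  have "(\<Sum>\<zeta>\<in>configs \<Lambda>. exp (- hamiltonian S U \<Lambda> (merge \<Lambda> (S - \<Lambda>) (\<zeta>, \<eta>))))
      = (\<Sum>\<zeta>\<in>configs \<Lambda>. \<Prod>r\<in>I. ?h r (local_layer \<Lambda> r \<zeta>))"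
    by (intro sum.cong refl weight)
  also have "\<dots> = (\<Sum>g\<in>(\<Pi>\<^sub>E r\<in>I. configs (slice \<Lambda> r)). \<Prod>r\<in>I. ?h r (g r))"
  \<comment> \<open>Cutting a configuration on \<open>\<Lambda>\<close> into slices and gluing the
    slices are mutually inverse.\<close>
  proof (rule sum.reindex_bij_witness[where i = "glue \<Lambda>" and j = "\<lambda>\<zeta>. \<lambda>r\<in>I. local_layer \<Lambda> r \<zeta>"])
    fix \<zeta> assume \<zeta>: "\<zeta> \<in> configs \<Lambda>"
    show "glue \<Lambda> (\<lambda>r\<in>I. local_layer \<Lambda> r \<zeta>) = \<zeta>"
    proof
      fix s show "glue \<Lambda> (\<lambda>r\<in>I. local_layer \<Lambda> r \<zeta>) s = \<zeta> s"
        using \<zeta> in_I[of s] coords_in[of s] assms(2)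
        by (auto simp: glue_def local_layer_def configs_def PiE_iff extensional_def)
    qed
    show "(\<lambda>r\<in>I. local_layer \<Lambda> r \<zeta>) \<in> (\<Pi>\<^sub>E r\<in>I. configs (slice \<Lambda> r))"
      using local_layer_configs[OF \<zeta>] by auto
    show "(\<Prod>r\<in>I. ?h r ((\<lambda>r\<in>I. local_layer \<Lambda> r \<zeta>) r)) = (\<Prod>r\<in>I. ?h r (local_layer \<Lambda> r \<zeta>))"
      by (intro prod.cong) auto
  next
    fix g assume g: "g \<in> (\<Pi>\<^sub>E r\<in>I. configs (slice \<Lambda> r))"
    show "(\<lambda>r\<in>I. local_layer \<Lambda> r (glue \<Lambda> g)) = g"
      using g local_glue[OF g] by (intro PiE_ext[of _ I "\<lambda>r. configs (slice \<Lambda> r)"]) auto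
    show "glue \<Lambda> g \<in> configs \<Lambda>"
    proof (rule glue_configs[OF assms(2)])
      fix r x assume "r \<in> R" "x \<in> slice \<Lambda> r"
      moreover from this have "r \<in> I" using assms(7)[of r] by auto
      ultimately show "g r x \<in> spins" using g configs_spins[of "g r" "slice \<Lambda> r" x] by auto
    qed
  qed
  also have "\<dots> = (\<Prod>r\<in>I. \<Sum>\<zeta>\<in>configs (slice \<Lambda> r). ?h r \<zeta>)"
    using assms(1,5,6) by (intro prod_sum_PiE[symmetric]) (auto intro!: finite_configs finite_slice)
  finally show ?thesis
    unfolding gibbs_kernel_def weight[OF assms(3)] by (simp add: prod_dividef)
qed

end

section \<open>Conditioning one layer on the others\<close>

lemma gibbs_measureD:
  assumes "gibbs_measure S W \<mu>"
  shows "prob_space \<mu>" "sets \<mu> = sets (config_space S)" "space \<mu> = configs S"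
  using assms sets_eq_imp_space_eq[of \<mu> "config_space S"] by (auto simp: gibbs_measure_def)

context layered_potential begin

text \<open>The pullback of an outside event of the layer, intersected with \<open>D\<close>, is
  again outside \<open>\<Lambda>\<close> embedded in \<open>S\<close>, so the Gibbs equation of
  \<open>U\<close> applies to it. There the kernel of \<open>U\<close> sees only layer
  \<open>r\<close> and equals the kernel of \<open>V\<close>; division by the probability of
  \<open>D\<close> gives the equation for the conditioned law.\<close>

lemma conditional_layer_gibbs:
  assumes gibbs: "gibbs_measure S U \<mu>" and r: "r \<in> R" and "measure \<mu> D \<noteq> 0"
    and D_outside: "\<And>\<Lambda>. finite \<Lambda> \<Longrightarrow> \<Lambda> \<subseteq> L \<Longrightarrow> D \<in> sets (outside_algebra S (emb r ` \<Lambda>))"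
  shows "gibbs_measure L V (distr (uniform_measure \<mu> D) (config_space L) (layer r))"
    (is "gibbs_measure L V ?\<nu>")
proof -
  interpret prob_space \<mu> using gibbs by (rule gibbs_measureD)
  note sets = gibbs_measureD(2)[OF gibbs] and space = gibbs_measureD(3)[OF gibbs]
  have D: "D \<in> sets \<mu>"
    using D_outside[of "{}"] outside_algebra_subset[of S "emb r ` {}"] sets by auto
  have D0: "emeasure \<mu> D \<noteq> 0" "emeasure \<mu> D \<noteq> \<infinity>" "0 < prob D"
    using assms(3) by (auto simp: emeasure_eq_measure zero_less_measure_iff)
  have lay: "layer r \<in> measurable \<mu> (config_space L)"
    using layer_measurable[OF r] by (simp add: measurable_cong_sets[OF sets refl])
  then have lay': "layer r \<in> measurable (uniform_measure \<mu> D) (config_space L)"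
    by (simp add: measurable_cong_sets[OF sets_uniform_measure refl])
  interpret u: prob_space "uniform_measure \<mu> D"
    using D0 by (intro prob_space_uniform_measure)
  show ?thesis
    unfolding gibbs_measure_iff[OF potential_V countable_layer]
  proof (intro conjI allI impI)
    show "prob_space ?\<nu>" using lay' by (rule u.prob_space_distr)
    show "sets ?\<nu> = sets (config_space L)" by simp
    fix \<Lambda> \<xi> B
    assume \<Lambda>: "finite \<Lambda>" "\<Lambda> \<subseteq> L" "\<xi> \<in> configs \<Lambda>" and B: "B \<in> sets (outside_algebra L \<Lambda>)"
    let ?\<Lambda> = "emb r ` \<Lambda>"
    \<comment> \<open>This transports \<open>\<xi>\<close> to the embedded set. A constant family
      suffices for gluing because only layer \<open>r\<close> meets that set.\<close>
    define \<xi>' where "\<xi>' = glue ?\<Lambda> (\<lambda>_. \<xi>)"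
    have \<Lambda>': "finite ?\<Lambda>" "?\<Lambda> \<subseteq> S" using \<Lambda> r emb_in by auto
    have sl: "slice ?\<Lambda> r = \<Lambda>" by (rule slice_emb_image[OF r \<Lambda>(2)])
    have sl0: "slice ?\<Lambda> r' = {}" if "r' \<in> R - {r}" for r'
      using that \<Lambda>(2) r by (auto simp: slice_def emb_eq_iff subset_iff)
    have \<xi>': "\<xi>' \<in> configs ?\<Lambda>"
      unfolding \<xi>'_def
    proof (rule glue_configs[OF \<Lambda>'(2)])
      fix r' x assume x: "r' \<in> R" "x \<in> slice ?\<Lambda> r'"
      then have "x \<in> \<Lambda>" using sl0[of r'] sl by (cases "r' = r") auto
      then show "\<xi> x \<in> spins" by (rule configs_spins[OF \<Lambda>(3)])
    qed
    have local_xi: "local_layer ?\<Lambda> r \<xi>' = \<xi>"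
    proof
      fix x show "local_layer ?\<Lambda> r \<xi>' x = \<xi> x"
        using \<Lambda>(2,3) r unfolding \<xi>'_def local_layer_def sl
        by (auto simp: glue_emb subset_iff configs_def PiE_iff extensional_def)
    qed
    let ?C = "layer r -` B \<inter> configs S"
    have C: "?C \<in> sets (outside_algebra S ?\<Lambda>)"
      using measurable_sets[OF layer_measurable_outside_slice[OF r, of ?\<Lambda>], of B] B by (simp add: sl)
    have CD: "?C \<inter> D \<in> sets (outside_algebra S ?\<Lambda>)"
      by (rule sets.Int[OF C D_outside[OF \<Lambda>(1,2)]])
    have cyl: "layer r -` (cyl L \<Lambda> \<xi>) \<inter> configs S = cyl S ?\<Lambda> \<xi>'"
      using cyl_layers[OF \<Lambda>'(2) \<xi>', of "{r}"] r sl0 by (auto simp: sl local_xi)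
    have BL: "B \<in> sets (config_space L)" using B outside_algebra_subset by blast
    have "measure ?\<nu> (cyl L \<Lambda> \<xi> \<inter> B)
        = measure (uniform_measure \<mu> D) (layer r -` (cyl L \<Lambda> \<xi> \<inter> B) \<inter> space \<mu>)"
      using lay' BL cyl_in_sets[OF \<Lambda>] by (subst measure_distr) auto
    also have "\<dots> = prob (D \<inter> (layer r -` (cyl L \<Lambda> \<xi> \<inter> B) \<inter> space \<mu>)) / prob D"
      using BL cyl_in_sets[OF \<Lambda>] by (intro measure_uniform_measure D0 measurable_sets[OF lay]) auto
    also have "D \<inter> (layer r -` (cyl L \<Lambda> \<xi> \<inter> B) \<inter> space \<mu>) = cyl S ?\<Lambda> \<xi>' \<inter> (?C \<inter> D)"
      unfolding cyl[symmetric] space by auto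
    also have "prob \<dots> = (\<integral>\<eta>. indicator (?C \<inter> D) \<eta> * gibbs_kernel S U ?\<Lambda> \<xi>' \<eta> \<partial>\<mu>)"
      using gibbs \<Lambda>' \<xi>' CD unfolding gibbs_measure_iff[OF potential_U countable_sites] by blast
    also have "\<dots> = (\<integral>\<eta>. indicator D \<eta> * (indicator B (layer r \<eta>) * gibbs_kernel L V \<Lambda> \<xi> (layer r \<eta>)) \<partial>\<mu>)"
    proof (rule Bochner_Integration.integral_cong[OF refl])
      fix \<eta> assume "\<eta> \<in> space \<mu>"
      then have \<eta>: "\<eta> \<in> configs S" by (simp add: space)
      have "gibbs_kernel S U ?\<Lambda> \<xi>' \<eta> = gibbs_kernel L V \<Lambda> \<xi> (layer r \<eta>)"
        using gibbs_kernel_layers[OF \<Lambda>' \<xi>' \<eta>, of "{r}"] r sl0 by (simp add: sl local_xi)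
      then show "indicator (?C \<inter> D) \<eta> * gibbs_kernel S U ?\<Lambda> \<xi>' \<eta>
          = indicator D \<eta> * (indicator B (layer r \<eta>) * gibbs_kernel L V \<Lambda> \<xi> (layer r \<eta>))"
        using \<eta> by (auto simp: indicator_def)
    qed
    also have "(\<integral>\<eta>. indicator D \<eta> * (indicator B (layer r \<eta>) * gibbs_kernel L V \<Lambda> \<xi> (layer r \<eta>)) \<partial>\<mu>) / prob D
        = (\<integral>\<eta>. indicator B \<eta> * gibbs_kernel L V \<Lambda> \<xi> \<eta> \<partial>?\<nu>)"
    proof -
      let ?g = "\<lambda>\<eta>. indicator B \<eta> * gibbs_kernel L V \<Lambda> \<xi> \<eta>"
      have "gibbs_kernel L V \<Lambda> \<xi> \<in> borel_measurable (config_space L)"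
        by (rule gibbs_kernel_measurable_config_space[OF potential_V countable_layer \<Lambda>])
      then have g: "?g \<in> borel_measurable (config_space L)" using BL by measurable
      \<comment> \<open>Conditioning on \<open>D\<close> is rewritten with a real-valued density, so
        that \<open>integral_density\<close> applies.\<close>
      have unif: "uniform_measure \<mu> D = density \<mu> (\<lambda>\<eta>. ennreal (indicator D \<eta> / prob D))"
        unfolding uniform_measure_def
      proof (rule density_cong)
        have "indicator D \<eta> / emeasure \<mu> D = ennreal (indicator D \<eta> / prob D)" for \<eta>
          unfolding emeasure_eq_measure ennreal_indicator[symmetric]
          using D0(3) by (intro divide_ennreal) auto
        then show "AE \<eta> in \<mu>. indicator D \<eta> / emeasure \<mu> D = ennreal (indicator D \<eta> / prob D)"
          by simp
      qed (use D in measurable)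
      have "(\<integral>\<eta>. ?g \<eta> \<partial>?\<nu>) = (\<integral>\<eta>. ?g (layer r \<eta>) \<partial>uniform_measure \<mu> D)"
        by (rule integral_distr[OF lay' g])
      also have "\<dots> = (\<integral>\<eta>. (indicator D \<eta> / prob D) *\<^sub>R ?g (layer r \<eta>) \<partial>\<mu>)"
        unfolding unif using measurable_compose[OF lay g] D by (intro integral_density) auto
      also have "\<dots> = (\<integral>\<eta>. indicator D \<eta> * ?g (layer r \<eta>) / prob D \<partial>\<mu>)"
        by (intro Bochner_Integration.integral_cong) auto
      finally show ?thesis by simp
    qed
    finally show "measure ?\<nu> (cyl L \<Lambda> \<xi> \<inter> B) = (\<integral>\<eta>. indicator B \<eta> * gibbs_kernel L V \<Lambda> \<xi> \<eta> \<partial>?\<nu>)" .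
  qed
qed

end

section \<open>Independence, uniqueness and existence\<close>

locale layer_unique_potential = layered_potential S L R emb U V
  for S :: "'s set" and L :: "'t set" and R :: "'r set" and emb :: "'r \<Rightarrow> 't \<Rightarrow> 's"
    and U :: "'s set \<Rightarrow> ('s \<Rightarrow> real) \<Rightarrow> real" and V :: "'t set \<Rightarrow> ('t \<Rightarrow> real) \<Rightarrow> real" +
  fixes \<nu> :: "('t \<Rightarrow> real) measure"
  assumes gibbs_V: "gibbs_measure L V \<nu>"
    and gibbs_V_unique: "\<And>\<nu>'. gibbs_measure L V \<nu>' \<Longrightarrow> \<nu>' = \<nu>"
begin

text \<open>Induction over the layers: conditioned on the events of the layers treated so far, the
  next layer has a law that is Gibbs for \<open>V\<close>, hence equal to \<open>\<nu>\<close>, and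
  a factor splits off. One-layer instances give the marginals, the general case gives
  independence.\<close>

lemma layer_events_product:
  assumes gibbs: "gibbs_measure S U \<mu>" and "finite I" "I \<subseteq> R"
    and "\<And>r. r \<in> I \<Longrightarrow> A r \<in> sets (config_space L)"
  shows "measure \<mu> {\<sigma> \<in> configs S. \<forall>r\<in>I. layer r \<sigma> \<in> A r} = (\<Prod>r\<in>I. measure \<nu> (A r))"
  using assms(2-4)
proof (induction I rule: finite_induct)
  case empty
  interpret prob_space \<mu> using gibbs by (rule gibbs_measureD)
  show ?case using prob_space gibbs_measureD(3)[OF gibbs] by simp
next
  case (insert r I)
  interpret prob_space \<mu> using gibbs by (rule gibbs_measureD)
  note sets = gibbs_measureD(2)[OF gibbs] and space = gibbs_measureD(3)[OF gibbs]
  have r: "r \<in> R" and Ar: "A r \<in> sets (config_space L)" using insert.prems by auto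
  let ?D = "{\<sigma> \<in> configs S. \<forall>r\<in>I. layer r \<sigma> \<in> A r}"
  let ?E = "layer r -` A r \<inter> space \<mu>"
  have IH: "prob ?D = (\<Prod>r\<in>I. measure \<nu> (A r))"
    using insert.prems by (intro insert.IH) auto
  \<comment> \<open>The new layer \<open>r\<close> is not in \<open>I\<close>, so the layers that
    determine \<open>?D\<close> avoid every site of layer \<open>r\<close>.\<close>
  have out: "?D \<in> sets (outside_algebra S (emb r ` \<Lambda>))" if \<Lambda>: "\<Lambda> \<subseteq> L" for \<Lambda>
  proof -
    have "{\<sigma> \<in> space (outside_algebra S (emb r ` \<Lambda>)). \<forall>r'\<in>I. layer r' \<sigma> \<in> A r'}
        \<in> sets (outside_algebra S (emb r ` \<Lambda>))"
    proof (rule sets.sets_Collect_finite_All[OF _ insert.hyps(1)])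
      fix r' assume r': "r' \<in> I"
      then have "layer r' \<in> measurable (outside_algebra S (emb r ` \<Lambda>)) (config_space L)"
        using insert.prems(1) insert.hyps(2) \<Lambda>
        by (intro layer_measurable_outside) (auto simp: emb_eq_iff subset_iff)
      from measurable_sets[OF this insert.prems(2)[of r']] r'
      show "{\<sigma> \<in> space (outside_algebra S (emb r ` \<Lambda>)). layer r' \<sigma> \<in> A r'}
          \<in> sets (outside_algebra S (emb r ` \<Lambda>))"
        by (simp add: vimage_def Int_def conj_commute)
    qed
    then show ?thesis by simp
  qed
  have D: "?D \<in> sets \<mu>"
    using out[of "{}"] outside_algebra_subset[of S "emb r ` {}"] sets by auto
  have lay: "layer r \<in> measurable \<mu> (config_space L)"
    using layer_measurable[OF r] by (simp add: measurable_cong_sets[OF sets refl])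
  have E: "?E \<in> sets \<mu>" by (rule measurable_sets[OF lay Ar])
  have eq: "{\<sigma> \<in> configs S. \<forall>r\<in>insert r I. layer r \<sigma> \<in> A r} = ?D \<inter> ?E"
    using space by auto
  have "prob (?D \<inter> ?E) = measure \<nu> (A r) * prob ?D"
  \<comment> \<open>Conditioning needs positive probability; a null \<open>?D\<close> makes both
    sides 0.\<close>
  proof (cases "prob ?D = 0")
    case True
    moreover have "prob (?D \<inter> ?E) \<le> prob ?D" using D by (intro finite_measure_mono) auto
    ultimately show ?thesis using measure_nonneg[of \<mu> "?D \<inter> ?E"] by simp
  next
    case False
    have D0: "emeasure \<mu> ?D \<noteq> 0" "emeasure \<mu> ?D \<noteq> \<infinity>" using False by (auto simp: emeasure_eq_measure)
    have "distr (uniform_measure \<mu> ?D) (config_space L) (layer r) = \<nu>"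
      by (intro gibbs_V_unique conditional_layer_gibbs[OF gibbs r False] out)
    then have "measure \<nu> (A r) = measure (distr (uniform_measure \<mu> ?D) (config_space L) (layer r)) (A r)"
      by simp
    also have "\<dots> = measure (uniform_measure \<mu> ?D) ?E"
      using lay by (subst measure_distr[OF _ Ar]) (simp_all add: measurable_cong_sets[OF sets_uniform_measure refl])
    also have "\<dots> = prob (?D \<inter> ?E) / prob ?D"
      by (rule measure_uniform_measure[OF D0 E])
    finally show ?thesis using False by simp
  qed
  then show ?case
    unfolding eq prod.insert[OF insert.hyps] IH .
qed

lemma distr_layer:
  assumes gibbs: "gibbs_measure S U \<mu>" and r: "r \<in> R"
  shows "distr \<mu> (config_space L) (layer r) = \<nu>"
proof (rule measure_eqI)
  interpret prob_space \<mu> using gibbs by (rule gibbs_measureD)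
  interpret v: prob_space \<nu> using gibbs_V by (rule gibbs_measureD)
  note sets = gibbs_measureD(2)[OF gibbs] and space = gibbs_measureD(3)[OF gibbs]
  show "sets (distr \<mu> (config_space L) (layer r)) = sets \<nu>"
    using gibbs_measureD(2)[OF gibbs_V] by simp
  fix A assume "A \<in> sets (distr \<mu> (config_space L) (layer r))"
  then have A: "A \<in> sets (config_space L)" by simp
  have lay: "layer r \<in> measurable \<mu> (config_space L)"
    using layer_measurable[OF r] by (simp add: measurable_cong_sets[OF sets refl])
  have "layer r -` A \<inter> space \<mu> = {\<sigma> \<in> configs S. \<forall>r'\<in>{r}. layer r' \<sigma> \<in> A}"
    using space by auto
  then show "emeasure (distr \<mu> (config_space L) (layer r)) A = emeasure \<nu> A"
    using layer_events_product[OF gibbs, of "{r}" "\<lambda>_. A"] r A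
    by (simp add: emeasure_distr[OF lay A] emeasure_eq_measure v.emeasure_eq_measure)
qed

lemma layers_indep:
  assumes gibbs: "gibbs_measure S U \<mu>"
  shows "prob_space.indep_vars \<mu> (\<lambda>_. config_space L) layer R"
proof -
  interpret prob_space \<mu> using gibbs by (rule gibbs_measureD)
  note sets = gibbs_measureD(2)[OF gibbs] and space = gibbs_measureD(3)[OF gibbs]
  have lay: "layer r \<in> measurable \<mu> (config_space L)" if "r \<in> R" for r
    using layer_measurable[OF that] by (simp add: measurable_cong_sets[OF sets refl])
  show ?thesis
    unfolding indep_vars_def2
  proof (intro conjI ballI lay indep_setsI)
    fix r assume "r \<in> R"
    then show "{layer r -` A \<inter> space \<mu> |A. A \<in> sets (config_space L)} \<subseteq> events"
      using measurable_sets[OF lay] by auto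
  next
    fix F J assume J: "J \<noteq> {}" "J \<subseteq> R" "finite J"
      and "\<forall>j\<in>J. F j \<in> {layer j -` A \<inter> space \<mu> |A. A \<in> sets (config_space L)}"
    then obtain A where A: "\<And>j. j \<in> J \<Longrightarrow> F j = layer j -` A j \<inter> space \<mu>"
        "\<And>j. j \<in> J \<Longrightarrow> A j \<in> sets (config_space L)"
      by (force dest: bchoice)
    have "(\<Inter>j\<in>J. F j) = {\<sigma> \<in> configs S. \<forall>r\<in>J. layer r \<sigma> \<in> A r}"
      using A(1) J(1) space by auto
    then have "prob (\<Inter>j\<in>J. F j) = (\<Prod>r\<in>J. measure \<nu> (A r))"
      using layer_events_product[OF gibbs J(3,2) A(2)] by simp
    also have "\<dots> = (\<Prod>j\<in>J. prob (F j))"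
    proof (rule prod.cong[OF refl])
      fix j assume j: "j \<in> J"
      then have "F j = {\<sigma> \<in> configs S. \<forall>r\<in>{j}. layer r \<sigma> \<in> A r}"
        using A(1) space by auto
      then show "measure \<nu> (A j) = prob (F j)"
        using layer_events_product[OF gibbs, of "{j}" A] j J(2) A(2) by (simp add: subset_iff)
    qed
    finally show "prob (\<Inter>j\<in>J. F j) = (\<Prod>j\<in>J. prob (F j))" .
  qed
qed

definition glued_product :: "('s \<Rightarrow> real) measure" where
  "glued_product = distr (PiM R (\<lambda>_. \<nu>)) (config_space S) (glue S)"

text \<open>Independence and the marginals fix the joint law of the layers as a product measure, and
  gluing recovers the configuration from its layers. Thus every Gibbs measure equals one explicit
  measure.\<close>

lemma gibbs_eq_glued_product:
  assumes gibbs: "gibbs_measure S U \<mu>"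
  shows "\<mu> = glued_product"
proof -
  interpret prob_space \<mu> using gibbs by (rule gibbs_measureD)
  note sets = gibbs_measureD(2)[OF gibbs] and space = gibbs_measureD(3)[OF gibbs]
  let ?P = "PiM R (\<lambda>_. config_space L)" and ?X = "\<lambda>\<sigma>. \<lambda>r\<in>R. layer r \<sigma>"
  have lay: "layer r \<in> measurable \<mu> (config_space L)" if "r \<in> R" for r
    using layer_measurable[OF that] by (simp add: measurable_cong_sets[OF sets refl])
  have X: "?X \<in> measurable \<mu> ?P" by (intro measurable_restrict lay)
  have "distr \<mu> ?P ?X = PiM R (\<lambda>r. distr \<mu> (config_space L) (layer r))"
    using layers_indep[OF gibbs] indep_vars_iff_distr_eq_PiM'[OF layers_nonempty lay] by simp
  also have "\<dots> = PiM R (\<lambda>_. \<nu>)" by (intro PiM_cong refl distr_layer[OF gibbs])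
  finally have "glued_product = distr (distr \<mu> ?P ?X) (config_space S) (glue S)"
    by (simp add: glued_product_def)
  also have "\<dots> = distr \<mu> (config_space S) (glue S \<circ> ?X)"
    by (rule distr_distr[OF glue_measurable X])
  also have "\<dots> = distr \<mu> (config_space S) (\<lambda>\<sigma>. \<sigma>)"
    using glue_layers space by (intro distr_cong) auto
  also have "\<dots> = \<mu>" by (rule distr_id2[OF sets[symmetric]])
  finally show ?thesis by simp
qed

text \<open>Only finitely many layers enter, so the possibly infinite product reduces to its
  marginal on \<open>I\<close>, where the integral factorizes. The bound by 1 provides
  integrability.\<close>

lemma glued_product_integral:
  fixes f :: "'r \<Rightarrow> ('t \<Rightarrow> real) \<Rightarrow> real"
  assumes "finite I" "I \<subseteq> R" "\<And>r. r \<in> I \<Longrightarrow> f r \<in> borel_measurable (config_space L)"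
    and "\<And>r \<tau>. r \<in> I \<Longrightarrow> \<bar>f r \<tau>\<bar> \<le> 1"
  shows "(\<integral>\<sigma>. (\<Prod>r\<in>I. f r (layer r \<sigma>)) \<partial>glued_product) = (\<Prod>r\<in>I. \<integral>\<tau>. f r \<tau> \<partial>\<nu>)"
proof -
  interpret v: prob_space \<nu> using gibbs_V by (rule gibbs_measureD)
  interpret product_prob_space "\<lambda>_. \<nu>" R by unfold_locales
  note sets = gibbs_measureD(2)[OF gibbs_V] and space = gibbs_measureD(3)[OF gibbs_V]
  have setsP: "sets (PiM J (\<lambda>_. \<nu>)) = sets (PiM J (\<lambda>_. config_space L))" for J :: "'r set"
    by (intro sets_PiM_cong refl sets)
  have gm: "glue S \<in> measurable (PiM R (\<lambda>_. \<nu>)) (config_space S)"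
    using glue_measurable by (simp add: measurable_cong_sets[OF setsP refl])
  have fm: "f r \<in> borel_measurable \<nu>" if "r \<in> I" for r
    using assms(3)[OF that] by (simp add: measurable_cong_sets[OF sets refl])
  have fint: "integrable \<nu> (f r)" if "r \<in> I" for r
    by (rule v.integrable_const_bound[of _ 1]) (use assms(4) fm that in auto)
  have "(\<integral>\<sigma>. (\<Prod>r\<in>I. f r (layer r \<sigma>)) \<partial>glued_product)
      = (\<integral>t. (\<Prod>r\<in>I. f r (layer r (glue S t))) \<partial>PiM R (\<lambda>_. \<nu>))"
    unfolding glued_product_def
    using assms(2,3) by (intro integral_distr[OF gm] borel_measurable_prod
        measurable_compose[OF layer_measurable]) auto
  also have "\<dots> = (\<integral>t. (\<Prod>r\<in>I. f r (restrict t I r)) \<partial>PiM R (\<lambda>_. \<nu>))"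
  proof (intro Bochner_Integration.integral_cong refl prod.cong)
    fix t r assume "t \<in> space (PiM R (\<lambda>_. \<nu>))" and r: "r \<in> I"
    then have "t r \<in> configs L" using assms(2) space by (auto simp: space_PiM)
    then have "layer r (glue S t) = t r"
      using r assms(2) by (intro layer_glue) (auto simp: configs_def PiE_iff)
    then show "f r (layer r (glue S t)) = f r (restrict t I r)" using r by simp
  qed
  also have "\<dots> = (\<integral>t. (\<Prod>r\<in>I. f r (t r)) \<partial>distr (PiM R (\<lambda>_. \<nu>)) (PiM I (\<lambda>_. \<nu>)) (\<lambda>t. restrict t I))"
    using assms(2) fm
    by (intro integral_distr[symmetric] measurable_restrict_subset borel_measurable_prod)
      (auto intro: measurable_compose[OF measurable_component_singleton])
  also have "\<dots> = (\<integral>t. (\<Prod>r\<in>I. f r (t r)) \<partial>PiM I (\<lambda>_. \<nu>))"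
    using distr_PiM_restrict_finite[OF assms(1,2)] by simp
  also have "\<dots> = (\<Prod>r\<in>I. \<integral>\<tau>. f r \<tau> \<partial>\<nu>)"
    by (rule product_integral_prod[OF assms(1) fint])
  finally show ?thesis .
qed

text \<open>On cylinders, the indicators and the kernel of \<open>U\<close> are all products over
  finitely many layers. Integrals of such products factorize, so the Gibbs equation for
  \<open>U\<close> becomes the product of those for \<open>V\<close> under
  \<open>\<nu>\<close>.\<close>

lemma gibbs_glued_product: "gibbs_measure S U glued_product"
proof (rule gibbs_measureI[OF potential_U countable_sites])
  interpret v: prob_space \<nu> using gibbs_V by (rule gibbs_measureD)
  note setsv = gibbs_measureD(2)[OF gibbs_V] and spacev = gibbs_measureD(3)[OF gibbs_V]
  interpret P: prob_space "PiM R (\<lambda>_. \<nu>)" by (intro prob_space_PiM v.prob_space_axioms)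
  have setsP: "sets (PiM R (\<lambda>_. \<nu>)) = sets (PiM R (\<lambda>_. config_space L))"
    by (intro sets_PiM_cong refl setsv)
  show "prob_space glued_product"
    unfolding glued_product_def using glue_measurable
    by (intro P.prob_space_distr) (simp add: measurable_cong_sets[OF setsP refl])
  then interpret g: prob_space glued_product .
  show sets: "sets glued_product = sets (config_space S)" by (simp add: glued_product_def)
  have space: "space glued_product = configs S" by (simp add: glued_product_def)
  fix \<Lambda> \<xi> \<Delta> E
  assume \<Lambda>: "finite \<Lambda>" "\<Lambda> \<subseteq> S" "\<xi> \<in> configs \<Lambda>" and \<Delta>: "finite \<Delta>" "\<Delta> \<subseteq> S - \<Lambda>"
  let ?B = "{\<sigma> \<in> configs S. \<forall>x\<in>\<Delta>. \<sigma> x \<in> E x}"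
  \<comment> \<open>The layers met by \<open>\<Lambda>\<close> or \<open>\<Delta>\<close>: both the
    cylinder and the test event must factorize over the same index set.\<close>
  define I where "I = fst ` coords ` (\<Lambda> \<union> \<Delta>)"
  define B where "B r = {\<tau> \<in> configs L. \<forall>x\<in>slice \<Delta> r. \<tau> x \<in> E (emb r x)}" for r
  let ?C = "\<lambda>r. cyl L (slice \<Lambda> r) (local_layer \<Lambda> r \<xi>)"
  let ?K = "\<lambda>r. gibbs_kernel L V (slice \<Lambda> r) (local_layer \<Lambda> r \<xi>)"
  have I: "finite I" "I \<subseteq> R" using \<Lambda> \<Delta> coords_in by (auto simp: I_def)
  have inI: "r \<in> I" if "r \<in> R" "x \<in> L" "emb r x \<in> \<Lambda> \<union> \<Delta>" for r x
    using that coords_emb[of r x] by (force simp: I_def)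
  have sl0: "slice \<Lambda> r = {}" if "r \<in> R - I" for r
    using that inI[of r] by (auto simp: slice_def)
  have slices: "finite (slice \<Lambda> r)" "slice \<Lambda> r \<subseteq> L" "local_layer \<Lambda> r \<xi> \<in> configs (slice \<Lambda> r)"
    "finite (slice \<Delta> r)" if "r \<in> I" for r
    using that I(2) \<Lambda> \<Delta>(1) by (auto intro: finite_slice local_layer_configs simp: slice_subset)
  have B_iff: "\<sigma> \<in> ?B \<longleftrightarrow> (\<forall>r\<in>I. layer r \<sigma> \<in> B r)" if \<sigma>: "\<sigma> \<in> configs S" for \<sigma>
  proof
    assume "\<sigma> \<in> ?B"
    then show "\<forall>r\<in>I. layer r \<sigma> \<in> B r"
      using I(2) layer_configs[OF \<sigma>] by (auto simp: B_def slice_def layer_def)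
  next
    assume *: "\<forall>r\<in>I. layer r \<sigma> \<in> B r"
    have "\<sigma> s \<in> E s" if s: "s \<in> \<Delta>" for s
    proof -
      obtain r x where rx: "r \<in> R" "x \<in> L" "s = emb r x" using s \<Delta>(2) emb_cases[of s] by blast
      then have "r \<in> I" "x \<in> slice \<Delta> r" using inI[of r x] s by (auto simp: slice_def)
      with * have "layer r \<sigma> x \<in> E (emb r x)" unfolding B_def by blast
      then show ?thesis using rx by (simp add: layer_def)
    qed
    then show "\<sigma> \<in> ?B" using \<sigma> by auto
  qed
  have BL: "B r \<in> sets (config_space L)" if "r \<in> I" for r
    unfolding B_def by (intro cylinder_sets slices that slice_subset)
  have CL: "?C r \<in> sets (config_space L)" if "r \<in> I" for r
    by (intro cyl_in_sets slices that)
  \<comment> \<open>Since \<open>\<Delta>\<close> is disjoint from \<open>\<Lambda>\<close>, so are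
    their slices; this makes \<open>B r\<close> admissible in the Gibbs equation of
    \<open>\<nu>\<close>.\<close>
  have B_out: "B r \<in> sets (outside_algebra L (slice \<Lambda> r))" if "r \<in> I" for r
  proof -
    have "{\<tau> \<in> configs (L - slice \<Lambda> r). \<forall>x\<in>slice \<Delta> r. \<tau> x \<in> E (emb r x)}
        \<in> sets (config_space (L - slice \<Lambda> r))"
      using \<Delta>(2) by (intro cylinder_sets slices that) (auto simp: slice_def)
    moreover have "B r = (\<lambda>\<sigma>. restrict \<sigma> (L - slice \<Lambda> r)) -`
        {\<tau> \<in> configs (L - slice \<Lambda> r). \<forall>x\<in>slice \<Delta> r. \<tau> x \<in> E (emb r x)} \<inter> configs L"
      using \<Delta>(2) restrict_configs[of _ L "L - slice \<Lambda> r"] by (auto simp: B_def slice_def)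
    ultimately show ?thesis unfolding sets_outside_algebra by blast
  qed
  have K: "?K r \<in> borel_measurable (config_space L)" if "r \<in> I" for r
    by (rule gibbs_kernel_measurable_config_space[OF potential_V countable_layer slices(1-3)[OF that]])
  have K01: "0 \<le> ?K r \<tau>" "?K r \<tau> \<le> 1" if "r \<in> I" for r \<tau>
    using gibbs_kernel_bounds[OF slices(1,3)[OF that]] by auto
  have indB: "indicator ?B \<sigma> = (\<Prod>r\<in>I. indicator (B r) (layer r \<sigma>) :: real)"
    if "\<sigma> \<in> configs S" for \<sigma>
    using B_iff[OF that] I(1) by (auto simp: indicator_def)
  have indCB: "indicator (cyl S \<Lambda> \<xi> \<inter> ?B) \<sigma> = (\<Prod>r\<in>I. indicator (?C r \<inter> B r) (layer r \<sigma>) :: real)"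
    if "\<sigma> \<in> configs S" for \<sigma>
    using B_iff[OF that] cyl_layers[OF \<Lambda>(2,3) I(2) sl0] that I(1) by (auto simp: indicator_def)
  have "?B \<in> sets (config_space S)" using \<Delta> by (intro cylinder_sets) auto
  moreover have "cyl S \<Lambda> \<xi> \<inter> ?B \<inter> configs S = cyl S \<Lambda> \<xi> \<inter> ?B" by auto
  ultimately have "measure glued_product (cyl S \<Lambda> \<xi> \<inter> ?B)
      = (\<integral>\<sigma>. indicator (cyl S \<Lambda> \<xi> \<inter> ?B) \<sigma> \<partial>glued_product)"
    using cyl_in_sets[OF \<Lambda>] by (simp add: sets space)
  also have "\<dots> = (\<integral>\<sigma>. (\<Prod>r\<in>I. indicator (?C r \<inter> B r) (layer r \<sigma>)) \<partial>glued_product)"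
    by (intro Bochner_Integration.integral_cong refl indCB) (simp add: space)
  also have "\<dots> = (\<Prod>r\<in>I. \<integral>\<tau>. indicator (?C r \<inter> B r) \<tau> \<partial>\<nu>)"
    by (intro glued_product_integral I borel_measurable_indicator sets.Int BL CL)
      (auto simp: indicator_def)
  also have "\<dots> = (\<Prod>r\<in>I. \<integral>\<tau>. indicator (B r) \<tau> * ?K r \<tau> \<partial>\<nu>)"
  proof (rule prod.cong[OF refl])
    fix r assume r: "r \<in> I"
    have "?C r \<inter> B r \<inter> configs L = ?C r \<inter> B r" by (auto simp: B_def)
    then have "(\<integral>\<tau>. indicator (?C r \<inter> B r) \<tau> \<partial>\<nu>) = measure \<nu> (?C r \<inter> B r)"
      using BL[OF r] CL[OF r] by (simp add: setsv spacev)
    also have "\<dots> = (\<integral>\<tau>. indicator (B r) \<tau> * ?K r \<tau> \<partial>\<nu>)"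
      using gibbs_V slices[OF r] B_out[OF r]
      unfolding gibbs_measure_iff[OF potential_V countable_layer] by blast
    finally show "(\<integral>\<tau>. indicator (?C r \<inter> B r) \<tau> \<partial>\<nu>) = (\<integral>\<tau>. indicator (B r) \<tau> * ?K r \<tau> \<partial>\<nu>)" .
  qed
  also have "\<dots> = (\<integral>\<sigma>. (\<Prod>r\<in>I. indicator (B r) (layer r \<sigma>) * ?K r (layer r \<sigma>)) \<partial>glued_product)"
    by (intro glued_product_integral[symmetric] I borel_measurable_times borel_measurable_indicator BL K)
      (use K01 in \<open>auto simp: indicator_def\<close>)
  also have "\<dots> = (\<integral>\<sigma>. indicator ?B \<sigma> * gibbs_kernel S U \<Lambda> \<xi> \<sigma> \<partial>glued_product)"
  proof (rule Bochner_Integration.integral_cong[OF refl])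
    fix \<sigma> assume "\<sigma> \<in> space glued_product"
    then have \<sigma>: "\<sigma> \<in> configs S" by (simp add: space)
    show "(\<Prod>r\<in>I. indicator (B r) (layer r \<sigma>) * ?K r (layer r \<sigma>))
        = indicator ?B \<sigma> * gibbs_kernel S U \<Lambda> \<xi> \<sigma>"
      using gibbs_kernel_layers[OF \<Lambda> \<sigma> I] sl0 by (simp add: indB[OF \<sigma>] prod.distrib)
  qed
  finally show "measure glued_product (cyl S \<Lambda> \<xi> \<inter> ?B)
      = (\<integral>\<sigma>. indicator ?B \<sigma> * gibbs_kernel S U \<Lambda> \<xi> \<sigma> \<partial>glued_product)" .
qed

end

section \<open>The multiplicative model\<close>

lemma monomial_add: "monomial d p (lattice_add d x y) = monomial d p x * monomial d p y"
  by (simp add: monomial_def lattice_add_def power_add prod.distrib)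

lemma lattice_add_in: "lattice_add d x y \<in> lattice d"
  by (simp add: lattice_add_def lattice_def)

lemma lattice_eqI: "x \<in> lattice d \<Longrightarrow> y \<in> lattice d \<Longrightarrow> (\<And>k. k \<in> {1..d} \<Longrightarrow> x k = y k) \<Longrightarrow> x = y"
  unfolding lattice_def by (rule PiE_ext)

lemma monomial_single:
  assumes "k \<in> {1..d}"
  shows "monomial d p (\<lambda>j\<in>{1..d}. if j = k then 1 else 0) = p k"
proof -
  have "monomial d p (\<lambda>j\<in>{1..d}. if j = k then 1 else 0) = (\<Prod>j=1..d. if j = k then p j else 1)"
    unfolding monomial_def by (intro prod.cong) auto
  then show ?thesis using assms by simp
qed

context
  fixes d :: nat and p :: "nat \<Rightarrow> nat"
  assumes prime_p: "\<And>k. k \<in> {1..d} \<Longrightarrow> prime (p k)"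
    and inj_p: "inj_on p {1..d}"
begin

lemma monomial_pos: "0 < monomial d p x"
  unfolding monomial_def using prime_p by (intro prod_pos) (auto intro: prime_gt_0_nat)

lemma one_in_layers: "1 \<in> layers d p"
proof -
  have "\<not> p k dvd 1" if "k \<in> {1..d}" for k
    using prime_gt_1_nat[OF prime_p[OF that]] by simp
  then show ?thesis by (simp add: layers_def)
qed

text \<open>The primes are distinct and none of them divides \<open>r\<close>, so each exponent can
  be read off as a multiplicity. This yields uniqueness of the decomposition.\<close>

lemma multiplicity_layer_monomial:
  assumes "r \<in> layers d p" "k \<in> {1..d}"
  shows "multiplicity (p k) (r * monomial d p x) = x k"
proof -
  have k: "prime (p k)" using prime_p assms(2) by auto
  have pw: "multiplicity (p k) (p j ^ x j) = (if j = k then x k else 0)" if "j \<in> {1..d}" for j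
  proof (cases "j = k")
    case True
    then show ?thesis using k by (simp add: multiplicity_same_power prime_gt_0_nat)
  next
    case False
    then have "p j \<noteq> p k" using inj_p that assms(2) by (auto dest: inj_onD)
    then have "multiplicity (p k) (p j) = 0"
      using k prime_p[OF that] by (simp add: prime_multiplicity_other)
    then show ?thesis
      using k prime_p[OF that] False by (simp add: prime_elem_multiplicity_power_distrib)
  qed
  have "multiplicity (p k) (monomial d p x) = (\<Sum>j=1..d. multiplicity (p k) (p j ^ x j))"
    unfolding monomial_def
  proof (rule prime_elem_multiplicity_prod_distrib)
    show "0 \<notin> (\<lambda>j. p j ^ x j) ` {1..d}"
    proof
      assume "0 \<in> (\<lambda>j. p j ^ x j) ` {1..d}"
      then obtain j where j: "j \<in> {1..d}" "0 = p j ^ x j" by (rule imageE)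
      then show False using prime_gt_0_nat[OF prime_p[OF j(1)]] by simp
    qed
  qed (use k in simp_all)
  also have "\<dots> = (\<Sum>j=1..d. if j = k then x k else 0)" by (intro sum.cong refl pw)
  also have "\<dots> = x k" using assms(2) by simp
  finally have m: "multiplicity (p k) (monomial d p x) = x k" .
  have "\<not> p k dvd r" "0 < r" using assms by (auto simp: layers_def)
  then have "multiplicity (p k) r = 0" by (simp add: not_dvd_imp_multiplicity_0)
  then show ?thesis
    using k m \<open>0 < r\<close> monomial_pos[of x] by (simp add: prime_elem_multiplicity_mult_distrib)
qed

lemma layer_monomial_inj:
  assumes "r \<in> layers d p" "x \<in> lattice d" "r' \<in> layers d p" "x' \<in> lattice d"
    and eq: "r * monomial d p x = r' * monomial d p x'"
  shows "r = r' \<and> x = x'"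
proof -
  have "x = x'"
    using assms(2,4)
  proof (rule lattice_eqI)
    fix k assume "k \<in> {1..d}"
    then show "x k = x' k"
      using multiplicity_layer_monomial[OF assms(1), of k x]
        multiplicity_layer_monomial[OF assms(3), of k x'] eq by simp
  qed
  then show ?thesis using eq monomial_pos[of x] by simp
qed

text \<open>Strong induction: as long as some \<open>p k\<close> divides the number, divide it out
  and record it as a unit step in direction \<open>k\<close>.\<close>

lemma layer_monomial_exists:
  assumes "1 \<le> n"
  shows "\<exists>r\<in>layers d p. \<exists>x\<in>lattice d. n = r * monomial d p x"
  using assms
proof (induction n rule: less_induct)
  case (less n)
  show ?case
  proof (cases "n \<in> layers d p")
    case True
    have "monomial d p (\<lambda>k\<in>{1..d}. 0) = 1" by (simp add: monomial_def)
    moreover have "(\<lambda>k\<in>{1..d}. 0) \<in> lattice d" by (simp add: lattice_def)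
    ultimately show ?thesis using True by (metis mult.right_neutral)
  next
    case False
    then obtain k where k: "k \<in> {1..d}" "p k dvd n" using less.prems by (auto simp: layers_def)
    then obtain n' where n': "n = p k * n'" by (auto elim: dvdE)
    have "1 < p k" using prime_p[OF k(1)] by (rule prime_gt_1_nat)
    then have "n' < n" "1 \<le> n'" using n' less.prems by auto
    then obtain r x where rx: "r \<in> layers d p" "x \<in> lattice d" "n' = r * monomial d p x"
      using less.IH by blast
    have "n = r * monomial d p (lattice_add d x (\<lambda>j\<in>{1..d}. if j = k then 1 else 0))"
      unfolding monomial_add monomial_single[OF k(1)] n' rx(3) by simp
    then show ?thesis using rx(1) lattice_add_in by blast
  qed
qed

lemma layered_sites_nat:
  "layered_sites {1..} (lattice d) (layers d p) (\<lambda>r x. r * monomial d p x)"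
proof
  show "bij_betw (\<lambda>(r, x). r * monomial d p x) (layers d p \<times> lattice d) {1..}"
    unfolding bij_betw_def
  proof
    show "inj_on (\<lambda>(r, x). r * monomial d p x) (layers d p \<times> lattice d)"
    proof (rule inj_onI)
      fix a b assume "a \<in> layers d p \<times> lattice d" "b \<in> layers d p \<times> lattice d"
        "(\<lambda>(r, x). r * monomial d p x) a = (\<lambda>(r, x). r * monomial d p x) b"
      then show "a = b"
        using layer_monomial_inj[of "fst a" "snd a" "fst b" "snd b"] by (auto simp: prod_eq_iff case_prod_beta)
    qed
    show "(\<lambda>(r, x). r * monomial d p x) ` (layers d p \<times> lattice d) = {1..}"
    proof
      show "(\<lambda>(r, x). r * monomial d p x) ` (layers d p \<times> lattice d) \<subseteq> {1..}"
        using monomial_pos by (auto simp: layers_def Suc_le_eq)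
      show "{1..} \<subseteq> (\<lambda>(r, x). r * monomial d p x) ` (layers d p \<times> lattice d)"
      proof
        fix n :: nat assume "n \<in> {1..}"
        then obtain r x where "r \<in> layers d p" "x \<in> lattice d" "n = r * monomial d p x"
          using layer_monomial_exists[of n] by auto
        then show "n \<in> (\<lambda>(r, x). r * monomial d p x) ` (layers d p \<times> lattice d)"
          by (intro image_eqI[of _ _ "(r, x)"]) auto
      qed
    qed
  qed
  show "layers d p \<noteq> {}" using one_in_layers by auto
qed simp

lemma monomial_inj: "inj_on (monomial d p) (lattice d)"
  using layer_monomial_inj[OF one_in_layers _ one_in_layers] by (auto simp: inj_on_def)

text \<open>Interaction sets lie in the layer of 1: a prime factor of \<open>r\<close> would divide
  the element \<open>a\<close>, hence be some \<open>p k\<close>, which membership in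
  \<open>layers d p\<close> forbids. So passing to exponents loses no point of
  \<open>A\<close>.\<close>

lemma monomial_image_exponents:
  assumes "A \<subseteq> {1..}" "\<And>a. a \<in> A \<Longrightarrow> prime_factors a \<subseteq> p ` {1..d}"
  shows "monomial d p ` exponents d p A = A"
proof
  show "monomial d p ` exponents d p A \<subseteq> A" by (auto simp: exponents_def)
  show "A \<subseteq> monomial d p ` exponents d p A"
  proof
    fix a assume a: "a \<in> A"
    then have "1 \<le> a" using assms(1) by auto
    then obtain r x where rx: "r \<in> layers d p" "x \<in> lattice d" "a = r * monomial d p x"
      using layer_monomial_exists by blast
    have "r = 1"
    proof (rule ccontr)
      assume "r \<noteq> 1"
      then obtain q where q: "prime q" "q dvd r" using prime_factor_nat[of r] by auto
      then have "q \<in> prime_factors a"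
        using rx \<open>1 \<le> a\<close> by (auto simp: in_prime_factors_iff)
      then obtain k where "k \<in> {1..d}" "q = p k" using assms(2)[OF a] by auto
      then show False using rx(1) q by (auto simp: layers_def)
    qed
    then show "a \<in> monomial d p ` exponents d p A"
      using rx a by (auto simp: exponents_def)
  qed
qed

end

section \<open>Dilates of interaction sets as translates inside a layer\<close>

text \<open>Writing \<open>i = r * monomial d p y\<close> splits a dilation into a choice of layer
  \<open>r\<close> and a translation by \<open>y\<close>. The supports of \<open>U\<close> in a
  layer are therefore exactly the embedded supports of \<open>V\<close>, with the same coupling
  \<open>J A\<close>.\<close>

lemma layered_potential_interaction:
  assumes pot: "potential {1..} U" and form: "interaction_form \<A> J U"
    and "inj_on p {1..d}" and primes: "primes_of \<A> = p ` {1..d}"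
    and assoc: "associated_potential d p \<A> J V"
  shows "layered_potential {1..} (lattice d) (layers d p) (\<lambda>r x. r * monomial d p x) U V"
proof -
  have pk: "prime (p k)" if "k \<in> {1..d}" for k
    using that primes by (auto simp: primes_of_def in_prime_factors_iff dest: equalityD2)
  interpret layered_sites "{1..}" "lattice d" "layers d p" "\<lambda>r x. r * monomial d p x"
    using pk assms(3) by (rule layered_sites_nat)
  let ?emb = "\<lambda>r x. r * monomial d p x"
  let ?T = "\<lambda>A y. (\<lambda>x. lattice_add d x y) ` exponents d p A"
  have exps: "monomial d p ` exponents d p A = A" if "A \<in> \<A>" for A
  proof (rule monomial_image_exponents[OF pk assms(3)])
    show "A \<subseteq> {1..}" using form that by (auto simp: interaction_form_def)
    show "prime_factors a \<subseteq> p ` {1..d}" if "a \<in> A" for a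
      using primes that \<open>A \<in> \<A>\<close> by (auto simp: primes_of_def)
  qed
  have img: "?emb r ` ?T A y = (*) (r * monomial d p y) ` A" if "A \<in> \<A>" for r y A
  proof -
    have "(*) (r * monomial d p y) ` A = (*) (r * monomial d p y) ` monomial d p ` exponents d p A"
      by (simp only: exps[OF that])
    also have "\<dots> = ?emb r ` ?T A y" by (simp add: image_image monomial_add ac_simps)
    finally show ?thesis by simp
  qed
  have T_lattice: "?T A y \<subseteq> lattice d" for A y using lattice_add_in by auto
  have dilate: "\<exists>r\<in>layers d p. \<exists>y\<in>lattice d. (*) i ` A = ?emb r ` ?T A y"
    if "1 \<le> i" "A \<in> \<A>" for i A
  proof -
    from that(1) obtain r y where "r \<in> layers d p" "y \<in> lattice d" "i = r * monomial d p y"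
      using emb_cases[of i] by auto
    then show ?thesis using img[OF that(2), of r y] by blast
  qed
  show ?thesis
  proof
    show "potential {1..} U" by fact
    fix B :: "nat set" and \<sigma> :: "nat \<Rightarrow> real"
    assume B: "finite B" "B \<subseteq> {1..}" "\<And>r. r \<in> layers d p \<Longrightarrow> \<not> B \<subseteq> ?emb r ` lattice d"
      and \<sigma>: "\<sigma> \<in> configs {1..}"
    \<comment> \<open>Every dilate lies within one layer by \<open>dilate\<close>, so a set
      contained in no layer carries no interaction.\<close>
    have "\<not> (\<exists>i\<ge>1. \<exists>A\<in>\<A>. B = (*) i ` A)"
      using dilate B(3) T_lattice by (metis image_mono)
    then show "U B \<sigma> = 0" using form B(1,2) \<sigma> by (simp add: interaction_form_def)
  next
    fix r B and \<sigma> :: "nat \<Rightarrow> real"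
    assume r: "r \<in> layers d p" and B: "finite B" "B \<subseteq> lattice d" and \<sigma>: "\<sigma> \<in> configs {1..}"
    show "U (?emb r ` B) \<sigma> = V B (layer r \<sigma>)"
    proof (cases "\<exists>A\<in>\<A>. \<exists>y\<in>lattice d. B = ?T A y")
      case True
      then obtain A y where A: "A \<in> \<A>" and y: "y \<in> lattice d" and B_eq: "B = ?T A y" by blast
      let ?i = "r * monomial d p y"
      have i: "1 \<le> ?i" using emb_in[OF r y] by simp
      have "U (?emb r ` B) \<sigma> = U ((*) ?i ` A) \<sigma>" unfolding B_eq img[OF A] ..
      also have "\<dots> = J A * (\<Prod>j\<in>A. mult_shift ?i \<sigma> j)"
        using form i A \<sigma> by (simp add: interaction_form_def)
      also have "(\<Prod>j\<in>A. mult_shift ?i \<sigma> j)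
          = (\<Prod>j\<in>monomial d p ` exponents d p A. mult_shift ?i \<sigma> j)"
        by (simp only: exps[OF A])
      also have "\<dots> = (\<Prod>x\<in>exponents d p A. mult_shift ?i \<sigma> (monomial d p x))"
        using inj_on_subset[OF monomial_inj[OF pk assms(3)], of "exponents d p A"]
        by (subst prod.reindex) (auto simp: exponents_def)
      \<comment> \<open>Multiplication by \<open>r * monomial d p y\<close> adds \<open>y\<close> to
        the exponents within layer \<open>r\<close>.\<close>
      also have "\<dots> = (\<Prod>x\<in>exponents d p A. layer r \<sigma> (lattice_add d x y))"
        using monomial_pos[OF pk assms(3)]
        by (intro prod.cong refl)
          (simp add: mult_shift_def layer_def lattice_add_in monomial_add Suc_le_eq ac_simps)
      also have "J A * \<dots> = V B (layer r \<sigma>)"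
        using assoc A y layer_configs[OF \<sigma> r] unfolding associated_potential_def B_eq by simp
      finally show ?thesis .
    next
      case False
      have "\<not> (\<exists>i\<ge>1. \<exists>A\<in>\<A>. ?emb r ` B = (*) i ` A)"
      proof
        assume "\<exists>i\<ge>1. \<exists>A\<in>\<A>. ?emb r ` B = (*) i ` A"
        then obtain A r' y where A: "A \<in> \<A>" and r': "r' \<in> layers d p" and y: "y \<in> lattice d"
          and eq: "?emb r ` B = ?emb r' ` ?T A y" using dilate by metis
        have "B = ?T A y"
        \<comment> \<open>A common point of the two embedded sets forces their layers to agree,
          after which injectivity gives equality in the lattice. The empty set determines no layer
          and is treated directly.\<close>
        proof (cases "B = {}")
          case True
          then show ?thesis using eq by simp
        next
          case False
          then obtain x x' where "x \<in> B" "x' \<in> ?T A y" "?emb r x = ?emb r' x'" using eq by blast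
          then have "r = r'"
            using emb_eq_iff[OF r _ r', of x x'] B(2) T_lattice[of y A] by blast
          then show ?thesis
            using eq inj_on_image_eq_iff[OF emb_inj[OF r] B(2) T_lattice[of y A]] by simp
        qed
        then show False using False A y by blast
      qed
      moreover have "?emb r ` B \<subseteq> {1..}" using emb_in[OF r] B(2) by blast
      ultimately have "U (?emb r ` B) \<sigma> = 0"
        using form B(1) \<sigma> by (simp add: interaction_form_def)
      moreover have "V B (layer r \<sigma>) = 0"
        using assoc False B layer_configs[OF \<sigma> r] by (simp add: associated_potential_def)
      ultimately show ?thesis by simp
    qed
  qed
qed

theorem theorem6p1:
  fixes \<A> :: "nat set set" and J :: "nat set \<Rightarrow> real"
    and U :: "nat set \<Rightarrow> (nat \<Rightarrow> real) \<Rightarrow> real"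
    and d :: nat and p :: "nat \<Rightarrow> nat"
    and V :: "(nat \<Rightarrow> nat) set \<Rightarrow> ((nat \<Rightarrow> nat) \<Rightarrow> real) \<Rightarrow> real"
    and \<mu>V :: "((nat \<Rightarrow> nat) \<Rightarrow> real) measure"
  assumes "potential {1..} U"
    and "mult_invariant U"
    and "interaction_form \<A> J U"
    and "d \<ge> 1"
    and "strict_mono_on {1..d} p"
    and "primes_of \<A> = p ` {1..d}"
    and "associated_potential d p \<A> J V"
    and "layer_unique d V"
    and "gibbs_measure (lattice d) V \<mu>V"
  shows "(\<exists>!\<mu>. gibbs_measure {1..} U \<mu>) \<and>
    (\<forall>\<mu>. gibbs_measure {1..} U \<mu> \<longrightarrow>
       prob_space.indep_vars \<mu> (\<lambda>_. config_space (lattice d)) (layer_spins d p) (layers d p) \<and>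
       (\<forall>r\<in>layers d p. distr \<mu> (config_space (lattice d)) (layer_spins d p r) = \<mu>V))"
proof -
  interpret layered_potential "{1..}" "lattice d" "layers d p" "\<lambda>r x. r * monomial d p x" U V
    using assms(1,3) strict_mono_on_imp_inj_on[OF assms(5)] assms(6,7)
    by (rule layered_potential_interaction)
  interpret layer_unique_potential "{1..}" "lattice d" "layers d p" "\<lambda>r x. r * monomial d p x" U V \<mu>V
  proof
    show "gibbs_measure (lattice d) V \<mu>V" by fact
    show "\<nu>' = \<mu>V" if "gibbs_measure (lattice d) V \<nu>'" for \<nu>'
      using assms(8,9) that unfolding layer_unique_def by (metis (full_types))
  qed
  \<comment> \<open>Identifies the abstract layer map with the \<open>\<tau>\<close> spins of the
    statement.\<close>
  have layer: "layer = layer_spins d p"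
    by (intro ext) (simp add: layer_def layer_spins_def)
  show ?thesis
  proof (intro conjI allI impI ballI)
    show "\<exists>!\<mu>. gibbs_measure {1..} U \<mu>"
      using gibbs_glued_product gibbs_eq_glued_product by (rule ex1I)
    fix \<mu> assume \<mu>: "gibbs_measure {1..} U \<mu>"
    show "prob_space.indep_vars \<mu> (\<lambda>_. config_space (lattice d)) (layer_spins d p) (layers d p)"
      using layers_indep[OF \<mu>] unfolding layer .
    fix r assume r: "r \<in> layers d p"
    show "distr \<mu> (config_space (lattice d)) (layer_spins d p r) = \<mu>V"
      by (rule distr_layer[OF \<mu> r, unfolded layer])
  qed
qed

end
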